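(* Let $\mathbf{\Sigma}$ be a nice topological pointclass, and assume that $\mathsf{Det}(\mathbf{\Sigma}(\omega^\omega))$ holds. Let $D\subseteq\mathcal{P}(\omega)$, let $Z$ be an uncountable zero-dimensional Polish space, and let $1\leq\xi<\omega_1$. If $\mathbf{\Gamma}_n\in\mathsf{NSD}_{\mathbf{\Sigma}}(Z)$ for $n\in\omega$ and $\mathbf{\Gamma}$ is the collection of all sets of the form $$\mathcal{H}_D(A_0,U_1,A_2,U_3,\ldots),$$ where $A_{2k}\in\mathbf{\Gamma}_k$ for every $k\in\omega$, $U_{2k+1}\in\mathbf{\Sigma}^0_\xi(Z)$ for every $k\in\omega$, and $U_{2i+1}\cap U_{2j+1}=\varnothing$ whenever $i\neq j$, then $\mathbf{\Gamma}\in\mathsf{NSD}(Z)$.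
   Context: Work in $\mathsf{ZF}+\mathsf{DC}$. "Space" means separable metrizable topological space. A space is zero-dimensional if it is non-empty and has a base of clopen sets. Determinacy: a set $S\subseteq\omega^\omega$ is determined if one of the players has a winning strategy in the game where I and II alternately play $x_0,y_0,x_1,y_1,\ldots\in\omega$ and I wins iff $(x_0,y_0,x_1,y_1,\ldots)\in S$. $\mathsf{Det}(\mathcal{S})$ means every element of $\mathcal{S}\subseteq\mathcal{P}(\omega^\omega)$ is determined. Pointclasses: a topological pointclass is a function $\mathbf{\Sigma}$ assigning to each space $Z$ a collection $\mathbf{\Sigma}(Z)\subseteq\mathcal{P}(Z)$ such that $f^{-1}[B]\in\mathbf{\Sigma}(Z)$ whenever $f:Z\to W$ is continuous and $B\in\mathbf{\Sigma}(W)$. A Borel space is a space homeomorphic to a Borel subset of a Polish space. $\mathbf{\Sigma}$ is nice if moreover, for every space $Z$: every Borel subset of $Z$ is in $\mathbf{\Sigma}(Z)$; $\mathbf{\Sigma}(Z)$ is a Boolean subalgebra of $\mathcal{P}(Z)$; $f^{-1}[B]\in\mathbf{\Sigma}(Z)$ whenever $f:Z\to W$ is a Borel function and $B\in\mathbf{\Sigma}(W)$; and if $j[Z]\in\mathbf{\Sigma}(W)$ for some Borel space $W$ and embedding $j:Z\to W$, then $i[Z]\in\mathbf{\Sigma}(W)$ for every Borel space $W$ and embedding $i:Z\to W$. Wadge classes: for $\mathbf{\Gamma}\subseteq\mathcal{P}(Z)$, the dual is $\check{\mathbf{\Gamma}}=\{Z\setminus A:A\in\mathbf{\Gamma}\}$;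 $\mathbf{\Gamma}$ is selfdual if $\mathbf{\Gamma}=\check{\mathbf{\Gamma}}$. A Wadge class in $Z$ is a collection of the form $\{f^{-1}[A]:f:Z\to Z\text{ continuous}\}$ for some $A\subseteq Z$. $\mathsf{NSD}(Z)$ is the set of all non-selfdual Wadge classes in $Z$, and $\mathsf{NSD}_{\mathbf{\Sigma}}(Z)=\{\mathbf{\Gamma}\in\mathsf{NSD}(Z):\mathbf{\Gamma}\subseteq\mathbf{\Sigma}(Z)\}$. Hausdorff operations: for $D\subseteq\mathcal{P}(\omega)$ and $B_0,B_1,\ldots\subseteq Z$, $\mathcal{H}_D(B_0,B_1,\ldots)=\{x\in Z:\{n\in\omega:x\in B_n\}\in D\}$. *)

theory Defs
  imports "HOL-Analysis.Analysis"
begin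

section \<open>Spaces\<close>

definition sep_metrizable :: "'a topology \<Rightarrow> bool" where
  "sep_metrizable X \<longleftrightarrow> metrizable_space X \<and> separable_space X"

definition polish :: "'a topology \<Rightarrow> bool" where
  "polish X \<longleftrightarrow> completely_metrizable_space X \<and> separable_space X"

definition zero_dimensional :: "'a topology \<Rightarrow> bool" where
  "zero_dimensional X \<longleftrightarrow> topspace X \<noteq> {} \<and>
     (\<exists>\<B>. (\<forall>B\<in>\<B>. openin X B \<and> closedin X B) \<and> openin X = arbitrary union_of (\<lambda>B. B \<in> \<B>))"

definition omega_omega :: "(nat \<Rightarrow> nat) topology" where
  "omega_omega = product_topology (\<lambda>_. discrete_topology UNIV) UNIV"

abbreviation preimage :: "'a topology \<Rightarrow> ('a \<Rightarrow> 'b) \<Rightarrow> 'b set \<Rightarrow> 'a set" where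
  "preimage Z f B \<equiv> {x \<in> topspace Z. f x \<in> B}"

definition borel_sets :: "'a topology \<Rightarrow> 'a set set" where
  "borel_sets X = sigma_sets (topspace X) {U. openin X U}"

definition borel_function :: "'a topology \<Rightarrow> 'b topology \<Rightarrow> ('a \<Rightarrow> 'b) \<Rightarrow> bool" where
  "borel_function Z W f \<longleftrightarrow>
     f \<in> topspace Z \<rightarrow> topspace W \<and> (\<forall>U. openin W U \<longrightarrow> preimage Z f U \<in> borel_sets Z)"

text \<open>It is no restriction to take the points of the Polish space \<open>P\<close> from the type
  \<open>nat \<Rightarrow> nat\<close>: see \<open>sep_metrizable_copy\<close> below.\<close>

definition borel_space :: "'a topology \<Rightarrow> bool" where
  "borel_space X \<longleftrightarrow> (\<exists>(P :: (nat \<Rightarrow> nat) topology) B. polish P \<and> B \<in> borel_sets P \<and>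
     X homeomorphic_space subtopology P B)"


section \<open>Determinacy\<close>

text \<open>A strategy maps each position (the finite list of all moves made so far, by both players)
  to the next move. Player I moves at the even stages, player II at the odd ones.\<close>

definition wins_I :: "(nat \<Rightarrow> nat) set \<Rightarrow> (nat list \<Rightarrow> nat) \<Rightarrow> bool" where
  "wins_I S \<sigma> \<longleftrightarrow> (\<forall>z. (\<forall>n. z (2 * n) = \<sigma> (map z [0..<2 * n])) \<longrightarrow> z \<in> S)"

definition wins_II :: "(nat \<Rightarrow> nat) set \<Rightarrow> (nat list \<Rightarrow> nat) \<Rightarrow> bool" where
  "wins_II S \<tau> \<longleftrightarrow> (\<forall>z. (\<forall>n. z (2 * n + 1) = \<tau> (map z [0..<2 * n + 1])) \<longrightarrow> z \<notin> S)"

definition determined :: "(nat \<Rightarrow> nat) set \<Rightarrow> bool" where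
  "determined S \<longleftrightarrow> (\<exists>\<sigma>. wins_I S \<sigma>) \<or> (\<exists>\<tau>. wins_II S \<tau>)"

definition Det :: "(nat \<Rightarrow> nat) set set \<Rightarrow> bool" where
  "Det \<S> \<longleftrightarrow> (\<forall>S\<in>\<S>. determined S)"


section \<open>Topological pointclasses\<close>

text \<open>A pointclass is a function on the class of all spaces, over which HOL cannot quantify.
  Every separable metrizable space has at most continuum many points, hence is homeomorphic to a
  space whose points are elements of the type \<open>nat \<Rightarrow> nat\<close> (with a topology that is in general
  unrelated to the one of \<open>omega_omega\<close>); see \<open>sep_metrizable_copy\<close> below. A pointclass is
  therefore given by its values on these spaces. By homeomorphism invariance its value on any
  other space is determined by them, and \<open>pointclass_on\<close> computes it; by \<open>pointclass_on_iff\<close> the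
  choice of the homeomorphic copy is immaterial.\<close>

type_synonym pointclass = "(nat \<Rightarrow> nat) topology \<Rightarrow> (nat \<Rightarrow> nat) set set"

definition topological_pointclass :: "pointclass \<Rightarrow> bool" where
  "topological_pointclass \<Sigma> \<longleftrightarrow>
     (\<forall>Z. sep_metrizable Z \<longrightarrow> \<Sigma> Z \<subseteq> Pow (topspace Z)) \<and>
     (\<forall>Z W f B. sep_metrizable Z \<and> sep_metrizable W \<and> continuous_map Z W f \<and> B \<in> \<Sigma> W
        \<longrightarrow> preimage Z f B \<in> \<Sigma> Z)"

definition nice_pointclass :: "pointclass \<Rightarrow> bool" where
  "nice_pointclass \<Sigma> \<longleftrightarrow> topological_pointclass \<Sigma> \<and>
     (\<forall>Z. sep_metrizable Z \<longrightarrow>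
        borel_sets Z \<subseteq> \<Sigma> Z \<and>
        algebra (topspace Z) (\<Sigma> Z) \<and>
        (\<forall>W f B. sep_metrizable W \<and> borel_function Z W f \<and> B \<in> \<Sigma> W \<longrightarrow> preimage Z f B \<in> \<Sigma> Z) \<and>
        ((\<exists>W j. borel_space W \<and> embedding_map Z W j \<and> j ` topspace Z \<in> \<Sigma> W) \<longrightarrow>
         (\<forall>W i. borel_space W \<and> embedding_map Z W i \<longrightarrow> i ` topspace Z \<in> \<Sigma> W)))"

definition pointclass_on :: "pointclass \<Rightarrow> 'a topology \<Rightarrow> 'a set set" where
  "pointclass_on \<Sigma> X = {A. A \<subseteq> topspace X \<and> (\<exists>W h. homeomorphic_map X W h \<and> h ` A \<in> \<Sigma> W)}"

lemma homeomorphic_map_sep_metrizable: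
  assumes "homeomorphic_map X Y h"
  shows "sep_metrizable X \<longleftrightarrow> sep_metrizable Y"
proof -
  have "X homeomorphic_space Y"
    using assms homeomorphic_map_imp_homeomorphic_space by blast
  then show ?thesis
    unfolding sep_metrizable_def
    using homeomorphic_metrizable_space homeomorphic_separable_space by blast
qed

lemma pointclass_on_iff:
  assumes \<Sigma>: "topological_pointclass \<Sigma>" and X: "sep_metrizable X" and h: "homeomorphic_map X W h"
  shows "A \<in> pointclass_on \<Sigma> X \<longleftrightarrow> A \<subseteq> topspace X \<and> h ` A \<in> \<Sigma> W"
proof
  assume "A \<in> pointclass_on \<Sigma> X"
  then obtain V k where A: "A \<subseteq> topspace X" and k: "homeomorphic_map X V k" and kA: "k ` A \<in> \<Sigma> V"
    unfolding pointclass_on_def by blast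
  obtain g where g: "homeomorphic_maps X W h g"
    using h homeomorphic_map_maps by blast
  then have gW: "continuous_map W X g" and hX: "h ` topspace X \<subseteq> topspace W"
    and gh: "\<And>x. x \<in> topspace X \<Longrightarrow> g (h x) = x" and hg: "\<And>y. y \<in> topspace W \<Longrightarrow> h (g y) = y"
    unfolding homeomorphic_maps_def by (auto dest: continuous_map_image_subset_topspace)
  have cont: "continuous_map W V (k \<circ> g)"
    using gW homeomorphic_imp_continuous_map[OF k] by (rule continuous_map_compose)
  have "preimage W (k \<circ> g) (k ` A) = h ` A"
  proof (intro equalityI subsetI)
    fix y assume y: "y \<in> preimage W (k \<circ> g) (k ` A)"
    then obtain a where a: "a \<in> A" "k (g y) = k a" by auto
    moreover have "g y \<in> topspace X"
      using gW y by (auto dest: continuous_map_image_subset_topspace)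
    ultimately have "g y = a"
      using A homeomorphic_imp_injective_map[OF k] by (auto dest: inj_onD)
    then show "y \<in> h ` A" using a hg y by force
  next
    fix y assume "y \<in> h ` A"
    then show "y \<in> preimage W (k \<circ> g) (k ` A)" using A hX gh by auto
  qed
  moreover have "preimage W (k \<circ> g) (k ` A) \<in> \<Sigma> W"
    using \<Sigma> cont kA X homeomorphic_map_sep_metrizable[OF h] homeomorphic_map_sep_metrizable[OF k]
    unfolding topological_pointclass_def by blast
  ultimately show "A \<subseteq> topspace X \<and> h ` A \<in> \<Sigma> W" using A by simp
next
  assume "A \<subseteq> topspace X \<and> h ` A \<in> \<Sigma> W"
  then show "A \<in> pointclass_on \<Sigma> X" using h unfolding pointclass_on_def by blast
qed

lemma pointclass_on_eq:
  assumes "topological_pointclass \<Sigma>" "sep_metrizable X"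
  shows "pointclass_on \<Sigma> X = \<Sigma> X"
proof -
  have "homeomorphic_map X X id" by simp
  from pointclass_on_iff[OF assms this] assms show ?thesis
    unfolding topological_pointclass_def by auto
qed

lemma sep_metrizable_copy:
  fixes X :: "'a topology"
  assumes "sep_metrizable X"
  shows "\<exists>W :: (nat \<Rightarrow> nat) topology. X homeomorphic_space W"
proof -
  obtain M d where Md: "Metric_space M d" "X = Metric_space.mtopology M d"
    using assms unfolding sep_metrizable_def metrizable_space_def by blast
  interpret Metric_space M d by (rule Md(1))
  obtain C where C: "countable C" "C \<subseteq> M" "X closure_of C = topspace X"
    using assms unfolding sep_metrizable_def separable_space_def Md(2) by auto
  define f :: "'a \<Rightarrow> nat \<Rightarrow> nat" where "f = (\<lambda>x k. case prod_decode k of (i, n) \<Rightarrow>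
    of_bool (d x (from_nat_into C i) < inverse (real (Suc n))))"
  have inj: "inj_on f (topspace X)"
  proof (rule inj_onI, rule ccontr)
    fix x y assume xy: "x \<in> topspace X" "y \<in> topspace X" "f x = f y" "x \<noteq> y"
    then have M: "x \<in> M" "y \<in> M" using Md(2) by auto
    then have "d x y / 2 > 0" using xy(4) by simp
    then obtain n where n: "inverse (real (Suc n)) < d x y / 2"
      using reals_Archimedean by blast
    have "x \<in> mball x (inverse (real (Suc n)))" using M(1) by simp
    then have "C \<inter> mball x (inverse (real (Suc n))) \<noteq> {}"
      using C(3) openin_mball unfolding Md(2) dense_intersects_open by blast
    then obtain c where c: "c \<in> C" "c \<in> mball x (inverse (real (Suc n)))" by blast
    obtain i where i: "from_nat_into C i = c"
      using from_nat_into_surj[OF C(1) c(1)] by blast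
    have "f x (prod_encode (i, n)) = 1"
      using c(2) i by (simp add: f_def)
    then have "f y (prod_encode (i, n)) = 1" using xy(3) by simp
    then have "d y c < inverse (real (Suc n))"
      using i by (cases "d y c < inverse (real (Suc n))") (simp_all add: f_def)
    moreover have "d x c < inverse (real (Suc n))" using c(2) by simp
    moreover have "d x y \<le> d x c + d y c"
      using triangle[of x c y] M C(2) c(1) commute[of c y] by auto
    ultimately show False using n by linarith
  qed
  define g where "g = inv_into (topspace X) f"
  define W where "W = pullback_topology (f ` topspace X) g X"
  have gf: "g (f x) = x" if "x \<in> topspace X" for x
    using inj that unfolding g_def by simp
  have top: "topspace W = f ` topspace X"
    unfolding W_def topspace_pullback_topology using gf by auto
  have contg: "continuous_map W X g"
    using continuous_map_pullback[of X X id, OF continuous_map_id, of "f ` topspace X" g]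
    unfolding W_def by simp
  have contf: "continuous_map X W f"
    unfolding W_def
  proof (rule continuous_map_pullback')
    show "continuous_map X X (g \<circ> f)"
      using continuous_map_eq[OF continuous_map_id, of X "g \<circ> f"] gf by simp
  qed auto
  have "homeomorphic_maps X W f g"
    using contf contg gf top unfolding homeomorphic_maps_def by auto
  then show ?thesis unfolding homeomorphic_space_def by blast
qed


section \<open>Wadge classes\<close>

definition dual_class :: "'a topology \<Rightarrow> 'a set set \<Rightarrow> 'a set set" where
  "dual_class Z \<Gamma> = {topspace Z - A | A. A \<in> \<Gamma>}"

definition selfdual :: "'a topology \<Rightarrow> 'a set set \<Rightarrow> bool" where
  "selfdual Z \<Gamma> \<longleftrightarrow> \<Gamma> = dual_class Z \<Gamma>"

definition wadge_class :: "'a topology \<Rightarrow> 'a set set \<Rightarrow> bool" where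
  "wadge_class Z \<Gamma> \<longleftrightarrow>
     (\<exists>A. A \<subseteq> topspace Z \<and> \<Gamma> = {preimage Z f A | f. continuous_map Z Z f})"

definition NSD :: "'a topology \<Rightarrow> 'a set set set" where
  "NSD Z = {\<Gamma>. wadge_class Z \<Gamma> \<and> \<not> selfdual Z \<Gamma>}"

definition NSD_in :: "pointclass \<Rightarrow> 'a topology \<Rightarrow> 'a set set set" where
  "NSD_in \<Sigma> Z = {\<Gamma> \<in> NSD Z. \<Gamma> \<subseteq> pointclass_on \<Sigma> Z}"


section \<open>Hausdorff operations\<close>

definition hausdorff_op :: "'a topology \<Rightarrow> nat set set \<Rightarrow> (nat \<Rightarrow> 'a set) \<Rightarrow> 'a set" where
  "hausdorff_op Z D B = {x \<in> topspace Z. {n. x \<in> B n} \<in> D}"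


section \<open>Countable ordinals and the additive Borel classes\<close>

text \<open>The type of all ordinals below the first uncountable ordinal.\<close>

typedef omega1 = "Field (cardSuc natLeq)"
proof -
  have "infinite (Field (cardSuc natLeq))"
    using cardSuc_finite[OF natLeq_Card_order] Field_natLeq by simp
  then have "Field (cardSuc natLeq) \<noteq> {}" by (metis finite.emptyI)
  then show ?thesis by blast
qed

lemma Well_order_cardSuc_natLeq: "Well_order (cardSuc natLeq)"
  using cardSuc_Card_order[OF natLeq_Card_order] card_order_on_def by blast

instantiation omega1 :: wellorder
begin

definition less_eq_omega1 :: "omega1 \<Rightarrow> omega1 \<Rightarrow> bool" where
  "\<alpha> \<le> \<beta> \<longleftrightarrow> (Rep_omega1 \<alpha>, Rep_omega1 \<beta>) \<in> cardSuc natLeq"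

definition less_omega1 :: "omega1 \<Rightarrow> omega1 \<Rightarrow> bool" where
  "(\<alpha> :: omega1) < \<beta> \<longleftrightarrow> \<alpha> \<le> \<beta> \<and> \<alpha> \<noteq> \<beta>"

instance
proof
  let ?R = "cardSuc natLeq"
  have lin: "refl_on (Field ?R) ?R" "trans ?R" "antisym ?R" "total_on (Field ?R) ?R" "wf (?R - Id)"
    using Well_order_cardSuc_natLeq
    by (auto simp: well_order_on_def linear_order_on_def partial_order_on_def preorder_on_def)
  fix x y z :: omega1
  show refl: "x \<le> x"
    using lin(1) Rep_omega1 by (auto simp: less_eq_omega1_def refl_on_def)
  show "x \<le> z" if "x \<le> y" "y \<le> z"
    using that lin(2) by (auto simp: less_eq_omega1_def dest: transD)
  show anti: "x = y" if "x \<le> y" "y \<le> x"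
    using that lin(3) by (auto simp: less_eq_omega1_def Rep_omega1_inject[symmetric] dest: antisymD)
  show "x < y \<longleftrightarrow> x \<le> y \<and> \<not> y \<le> x"
    using anti refl by (auto simp: less_omega1_def)
  show "x \<le> y \<or> y \<le> x"
    using lin(4) Rep_omega1[of x] Rep_omega1[of y] refl
    by (cases "x = y") (auto simp: less_eq_omega1_def total_on_def Rep_omega1_inject)
  fix P :: "omega1 \<Rightarrow> bool" and a
  assume step: "\<And>x. (\<And>y. y < x \<Longrightarrow> P y) \<Longrightarrow> P x"
  have "wf (inv_image (?R - Id) Rep_omega1)"
    using lin(5) by (rule wf_inv_image)
  then show "P a"
  proof (induction a rule: wf_induct_rule)
    case (less x)
    show ?case
    proof (rule step)
      fix y assume "y < x"
      then have "(y, x) \<in> inv_image (?R - Id) Rep_omega1"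
        by (simp add: less_omega1_def less_eq_omega1_def Rep_omega1_inject)
      then show "P y" by (rule less)
    qed
  qed
qed

end

instantiation omega1 :: "{zero, one}"
begin

definition zero_omega1 :: omega1 where
  "(0 :: omega1) = (LEAST \<alpha>. True)"

definition one_omega1 :: omega1 where
  "(1 :: omega1) = (LEAST \<alpha>. 0 < \<alpha>)"

instance ..

end

lemma countable_iff_card_le_natLeq:
  includes cardinal_syntax
  shows "countable A \<longleftrightarrow> |A| \<le>o natLeq"
proof -
  have "countable A \<longleftrightarrow> |A| \<le>o |UNIV :: nat set|"
    unfolding countable_def card_of_ordLeq[symmetric] by simp
  also have "\<dots> \<longleftrightarrow> |A| \<le>o natLeq"
    using card_of_nat ordIso_symmetric ordLeq_ordIso_trans by blast
  finally show ?thesis .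
qed

lemma countable_below_omega1:
  includes cardinal_syntax
  shows "countable {..<\<alpha> :: omega1}"
proof -
  let ?R = "cardSuc natLeq"
  have "|underS ?R (Rep_omega1 \<alpha>)| <o ?R"
    using card_of_underS[OF cardSuc_Card_order[OF natLeq_Card_order] Rep_omega1] .
  then have "|underS ?R (Rep_omega1 \<alpha>)| \<le>o natLeq"
    using cardSuc_ordLeq_ordLess[OF natLeq_Card_order card_of_Card_order] by blast
  then have "countable (underS ?R (Rep_omega1 \<alpha>))"
    by (simp add: countable_iff_card_le_natLeq)
  moreover have "Rep_omega1 ` {..<\<alpha>} \<subseteq> underS ?R (Rep_omega1 \<alpha>)"
    by (auto simp: underS_def less_omega1_def less_eq_omega1_def Rep_omega1_inject)
  ultimately have "countable (Rep_omega1 ` {..<\<alpha>})"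
    by (rule countable_subset[rotated])
  then show ?thesis
    by (rule countable_image_inj_on) (simp add: inj_on_def Rep_omega1_inject)
qed

lemma uncountable_omega1:
  includes cardinal_syntax
  shows "uncountable (UNIV :: omega1 set)"
proof
  let ?R = "cardSuc natLeq"
  assume "countable (UNIV :: omega1 set)"
  then have "countable (Rep_omega1 ` UNIV)" by (rule countable_image)
  then have "|Field ?R| \<le>o natLeq"
    using type_definition.Rep_range[OF type_definition_omega1]
    by (simp add: countable_iff_card_le_natLeq)
  moreover have "|Field ?R| =o ?R"
    using card_of_Field_ordIso[OF cardSuc_Card_order[OF natLeq_Card_order]] .
  ultimately have "?R \<le>o natLeq"
    using ordIso_ordLeq_trans ordIso_symmetric by blast
  then show False
    using cardSuc_greater[OF natLeq_Card_order] not_ordLess_ordLeq by blast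
qed

lemma zero_le_omega1: "0 \<le> (\<alpha> :: omega1)"
  unfolding zero_omega1_def by (rule Least_le) simp

lemma one_le_omega1_iff: "1 \<le> (\<alpha> :: omega1) \<longleftrightarrow> \<alpha> \<noteq> 0"
proof
  have "(UNIV :: omega1 set) \<noteq> {0}"
    using uncountable_omega1 by (metis countable_empty countable_insert)
  then have "\<exists>\<beta> :: omega1. 0 < \<beta>"
    using zero_le_omega1 by (auto simp: less_le)
  then have "(0 :: omega1) < 1"
    unfolding one_omega1_def by (rule LeastI_ex)
  then show "\<alpha> \<noteq> 0" if "1 \<le> \<alpha>" using that by auto
  show "1 \<le> \<alpha>" if "\<alpha> \<noteq> 0"
    unfolding one_omega1_def using that zero_le_omega1[of \<alpha>] by (intro Least_le) simp
qed

inductive_set additive_borel :: "'a topology \<Rightarrow> (omega1 \<times> 'a set) set" for Z where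
  open_sets: "openin Z U \<Longrightarrow> (1, U) \<in> additive_borel Z"
| union: "(\<And>n::nat. 1 \<le> \<eta> n \<and> \<eta> n < \<xi> \<and> (\<eta> n, A n) \<in> additive_borel Z) \<Longrightarrow>
     (\<xi>, \<Union>n. topspace Z - A n) \<in> additive_borel Z"

definition Sigma0 :: "omega1 \<Rightarrow> 'a topology \<Rightarrow> 'a set set" where
  "Sigma0 \<xi> Z = {A. (\<xi>, A) \<in> additive_borel Z}"

lemma Sigma0_one: "Sigma0 1 Z = {U. openin Z U}"
  unfolding Sigma0_def
  by (auto intro: additive_borel.open_sets elim!: additive_borel.cases dest: leD)

lemma Sigma0_gt_one:
  assumes "1 < \<xi>"
  shows "Sigma0 \<xi> Z = {\<Union>n::nat. topspace Z - A n | A.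
           \<forall>n. \<exists>\<eta>. 1 \<le> \<eta> \<and> \<eta> < \<xi> \<and> A n \<in> Sigma0 \<eta> Z}"
proof (intro equalityI subsetI)
  fix S assume "S \<in> Sigma0 \<xi> Z"
  then have "(\<xi>, S) \<in> additive_borel Z" unfolding Sigma0_def by simp
  then show "S \<in> {\<Union>n::nat. topspace Z - A n | A. \<forall>n. \<exists>\<eta>. 1 \<le> \<eta> \<and> \<eta> < \<xi> \<and> A n \<in> Sigma0 \<eta> Z}"
    by cases (use assms in \<open>auto simp: Sigma0_def\<close>)
next
  fix S assume "S \<in> {\<Union>n::nat. topspace Z - A n | A. \<forall>n. \<exists>\<eta>. 1 \<le> \<eta> \<and> \<eta> < \<xi> \<and> A n \<in> Sigma0 \<eta> Z}"
  then obtain A where S: "S = (\<Union>n::nat. topspace Z - A n)"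
    and "\<forall>n. \<exists>\<eta>. 1 \<le> \<eta> \<and> \<eta> < \<xi> \<and> A n \<in> Sigma0 \<eta> Z" by blast
  then obtain \<eta> where "\<forall>n. 1 \<le> \<eta> n \<and> \<eta> n < \<xi> \<and> A n \<in> Sigma0 (\<eta> n) Z" by metis
  then show "S \<in> Sigma0 \<xi> Z"
    unfolding S Sigma0_def mem_Collect_eq by (intro additive_borel.union[of \<eta>]) simp
qed

end

theory Submission
  imports Defs
begin

text \<open>Every space in sight is replaced by a retract of Baire space. A zero-dimensional Polish space
  \<open>Z\<close> is a retract of Baire space (\<open>retract_of_Baire_space\<close>), so a set \<open>A\<close> that generates a non-selfdual
  Wadge class in \<open>Z\<close> can be pulled back along the retraction to a non-selfdual set of sequences.
  The notion that carries the proof is \<open>universal\<close>: a labelling \<open>\<alpha>\<close> of the sequences is universal on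
  the cube of all sequences with entries in \<open>S\<close> if every labelling \<open>\<alpha> \<circ> f\<close> with continuous \<open>f\<close> is already
  \<open>\<alpha> \<circ> g\<close> for a map \<open>g\<close> that is given by a strategy with moves in \<open>S\<close>. Strategies are coded by points
  of the cube, so a diagonal argument (\<open>universal_diagonal\<close>) shows that no continuous map can
  change all labels of a universal labelling; in particular a universal set is not selfdual. On the
  other hand universality passes to countable products of labellings and to arbitrary functions of
  the label, hence to all Hausdorff operations, whatever \<open>D\<close> is. This is why determinacy of the sets
  in \<open>\<Sigma>\<close> suffices, although the members of \<open>\<Gamma>\<close> need not lie in \<open>\<Sigma>\<close>.

  Two kinds of universal labellings are fed into this machine. A non-selfdual set is universal by
  Wadge's lemma, which is where determinacy enters. For each \<open>\<xi>\<close>, a sequence of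
  disjoint additive sets of class \<open>\<xi>\<close> that is complete among all such sequences is built by recursion
  on \<open>\<xi>\<close>, by means of the reduction property (\<open>complete_disjoint_family\<close>).

  The Hausdorff operation \<open>D\<close>, applied to these sets in separate coordinates, gives a universal set
  \<open>W\<close> on the cube, and the class \<open>\<Gamma>\<close> consists of its continuous preimages. To make this a Wadge class in
  \<open>Z\<close>, the cube has to be a retract of \<open>Z\<close>. The case distinction is that of Hurewicz. If some
  non-empty closed subset of \<open>Z\<close> is nowhere locally compact, then Baire space is a retract of \<open>Z\<close> and
  \<open>S\<close> is the set of all natural numbers. Otherwise \<open>S = {0, 1}\<close>: Cantor space is a retract of the
  uncountable space \<open>Z\<close>, but now every generator of a class \<open>\<Gamma>\<^sub>n\<close> must be shown to be Wadge equivalent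
  to a subset of Cantor space. This is \<open>cantor_representation\<close>, which uses that each non-empty
  closed subset of \<open>Z\<close> has a non-empty compact relatively open subset.\<close>

section \<open>Continuity in Baire space\<close>

definition pre :: "(nat \<Rightarrow> nat) \<Rightarrow> nat \<Rightarrow> nat list" where
  "pre x n = map x [0..<n]"

lemma length_pre [simp]: "length (pre x n) = n"
  by (simp add: pre_def)

lemma nth_pre [simp]: "i < n \<Longrightarrow> pre x n ! i = x i"
  by (simp add: pre_def)

lemma pre_0 [simp]: "pre x 0 = []"
  by (simp add: pre_def)

lemma pre_Suc: "pre x (Suc n) = pre x n @ [x n]"
  by (simp add: pre_def)

lemma take_pre [simp]: "take k (pre x n) = pre x (min k n)"
  by (simp add: pre_def take_map min_def)

lemma pre_eq_iff: "pre x n = pre y n \<longleftrightarrow> (\<forall>i<n. x i = y i)"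
  by (auto simp: pre_def)

lemma pre_eq_mono: "pre x n = pre y n \<Longrightarrow> m \<le> n \<Longrightarrow> pre x m = pre y m"
  by (simp add: pre_eq_iff)

abbreviation cont :: "((nat \<Rightarrow> nat) \<Rightarrow> (nat \<Rightarrow> nat)) \<Rightarrow> bool" where
  "cont \<equiv> continuous_map omega_omega omega_omega"

lemma topspace_omega_omega [simp]: "topspace omega_omega = UNIV"
  by (auto simp: omega_omega_def)

lemma openin_omega_omega:
  "openin omega_omega U \<longleftrightarrow> (\<forall>x\<in>U. \<exists>n. \<forall>y. pre y n = pre x n \<longrightarrow> y \<in> U)"
proof
  assume U: "openin omega_omega U"
  show "\<forall>x\<in>U. \<exists>n. \<forall>y. pre y n = pre x n \<longrightarrow> y \<in> U"
  proof
    fix x assume "x \<in> U"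
    then obtain V where V: "finite {i. V i \<noteq> (UNIV :: nat set)}" "\<And>i. x i \<in> V i" "Pi\<^sub>E UNIV V \<subseteq> U"
      using U unfolding omega_omega_def openin_product_topology_alt by (auto simp: PiE_iff)
    obtain n where n: "\<And>i. V i \<noteq> UNIV \<Longrightarrow> i < n"
      using V(1) unfolding finite_nat_set_iff_bounded by auto
    have "y \<in> U" if "pre y n = pre x n" for y
    proof -
      have "y i \<in> V i" for i
        using n[of i] that V(2)[of i] by (cases "V i = UNIV") (auto simp: pre_eq_iff)
      then show ?thesis using V(3) by (auto simp: PiE_iff)
    qed
    then show "\<exists>n. \<forall>y. pre y n = pre x n \<longrightarrow> y \<in> U" by blast
  qed
next
  assume *: "\<forall>x\<in>U. \<exists>n. \<forall>y. pre y n = pre x n \<longrightarrow> y \<in> U"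
  show "openin omega_omega U"
    unfolding omega_omega_def openin_product_topology_alt
  proof
    fix x assume "x \<in> U"
    then obtain n where n: "\<And>y. pre y n = pre x n \<Longrightarrow> y \<in> U" using * by blast
    define V where "V = (\<lambda>i. if i < n then {x i} else UNIV)"
    have "{i \<in> UNIV. V i \<noteq> topspace (discrete_topology UNIV)} \<subseteq> {..<n}"
      by (auto simp: V_def)
    then have "finite {i \<in> UNIV. V i \<noteq> topspace (discrete_topology UNIV)}"
      using finite_subset by blast
    moreover have "x \<in> Pi\<^sub>E UNIV V" by (auto simp: V_def PiE_iff)
    moreover have "Pi\<^sub>E UNIV V \<subseteq> U"
    proof
      fix y assume y: "y \<in> Pi\<^sub>E UNIV V"
      have "y i = x i" if "i < n" for i
      proof -
        have "y i \<in> V i" using y by (simp add: PiE_iff)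
        then show ?thesis using that by (simp add: V_def)
      qed
      then show "y \<in> U" by (intro n) (simp add: pre_eq_iff)
    qed
    ultimately show "\<exists>V. finite {i \<in> UNIV. V i \<noteq> topspace (discrete_topology UNIV)} \<and>
        (\<forall>i\<in>UNIV. openin (discrete_topology UNIV) (V i)) \<and> x \<in> Pi\<^sub>E UNIV V \<and> Pi\<^sub>E UNIV V \<subseteq> U"
      by (intro exI[of _ V]) auto
  qed
qed

lemma continuous_map_omega_omega:
  "continuous_map Z omega_omega f \<longleftrightarrow>
     (\<forall>n a. openin Z {z \<in> topspace Z. f z n = a})"
proof -
  have "continuous_map Z omega_omega f \<longleftrightarrow>
      (\<forall>n. continuous_map Z (discrete_topology UNIV) (\<lambda>z. f z n))"
    unfolding omega_omega_def by (simp add: continuous_map_componentwise_UNIV)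
  also have "\<dots> \<longleftrightarrow> (\<forall>n a. openin Z {z \<in> topspace Z. f z n = a})"
  proof -
    have "continuous_map Z (discrete_topology UNIV) g \<longleftrightarrow> (\<forall>a. openin Z {z \<in> topspace Z. g z = a})"
      for g :: "_ \<Rightarrow> nat"
    proof
      assume "continuous_map Z (discrete_topology UNIV) g"
      then have "openin Z {z \<in> topspace Z. g z \<in> {a}}" for a
        by (rule openin_continuous_map_preimage) simp
      then show "\<forall>a. openin Z {z \<in> topspace Z. g z = a}" by simp
    next
      assume *: "\<forall>a. openin Z {z \<in> topspace Z. g z = a}"
      have "openin Z {z \<in> topspace Z. g z \<in> U}" for U
      proof -
        have "{z \<in> topspace Z. g z \<in> U} = (\<Union>a\<in>U. {z \<in> topspace Z. g z = a})" by auto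
        then show ?thesis using * by auto
      qed
      then show "continuous_map Z (discrete_topology UNIV) g"
        by (auto simp: continuous_map_def)
    qed
    from this[of "\<lambda>z. f z _"] show ?thesis by simp
  qed
  finally show ?thesis .
qed

lemma cont_iff:
  "cont f \<longleftrightarrow> (\<forall>x n. \<exists>m. \<forall>y. pre y m = pre x m \<longrightarrow> f y n = f x n)"
proof
  assume "cont f"
  then have *: "openin omega_omega {z. f z n = a}" for n a
    using continuous_map_omega_omega[of omega_omega f] by simp
  show "\<forall>x n. \<exists>m. \<forall>y. pre y m = pre x m \<longrightarrow> f y n = f x n"
  proof (intro allI)
    fix x n
    show "\<exists>m. \<forall>y. pre y m = pre x m \<longrightarrow> f y n = f x n"
      using *[of n "f x n"] unfolding openin_omega_omega by blast
  qed
next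
  assume *: "\<forall>x n. \<exists>m. \<forall>y. pre y m = pre x m \<longrightarrow> f y n = f x n"
  have "openin omega_omega {z. f z n = a}" for n a
    unfolding openin_omega_omega
  proof
    fix x assume "x \<in> {z. f z n = a}"
    then show "\<exists>m. \<forall>y. pre y m = pre x m \<longrightarrow> y \<in> {z. f z n = a}"
      using *[rule_format, of x n] by simp
  qed
  then show "cont f" using continuous_map_omega_omega[of omega_omega f] by simp
qed

lemma contI:
  assumes "\<And>x n. \<exists>m. \<forall>y. pre y m = pre x m \<longrightarrow> f y n = f x n"
  shows "cont f"
  using assms by (simp add: cont_iff)

text \<open>Continuity gives one modulus for each coordinate; the largest of finitely many of them serves for a whole
  prefix of the image.\<close>

lemma cont_pre:
  assumes "cont f"
  obtains m where "n \<le> m" "\<And>y. pre y m = pre x m \<Longrightarrow> pre (f y) n = pre (f x) n"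
proof -
  have "\<exists>m. \<forall>y. pre y m = pre x m \<longrightarrow> f y i = f x i" for i
    using assms by (simp add: cont_iff)
  then obtain m where m: "\<And>i y. pre y (m i) = pre x (m i) \<Longrightarrow> f y i = f x i" by metis
  define k where "k = Max (insert n (m ` {..<n}))"
  have k: "m i \<le> k" if "i < n" for i
    unfolding k_def using that by (intro Max_ge) auto
  have nk: "n \<le> k" unfolding k_def by (intro Max_ge) auto
  show ?thesis
  proof (rule that[OF nk])
    fix y assume "pre y k = pre x k"
    then show "pre (f y) n = pre (f x) n"
      unfolding pre_eq_iff[of "f y"] using m[OF pre_eq_mono[OF _ k]] by blast
  qed
qed

lemma cont_comp: "cont f \<Longrightarrow> cont g \<Longrightarrow> cont (\<lambda>x. f (g x))"
  using continuous_map_compose[of _ _ g _ f] by (simp add: comp_def)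

lemma cont_comp': "continuous_map Z omega_omega g \<Longrightarrow> cont f \<Longrightarrow> continuous_map Z omega_omega (\<lambda>x. f (g x))"
  using continuous_map_compose[of _ _ g _ f] by (simp add: comp_def)

lemma cont_id: "cont (\<lambda>x. x)"
  by simp

section \<open>Universal labellings\<close>

definition cube :: "nat set \<Rightarrow> (nat \<Rightarrow> nat) set" where
  "cube S = {x. \<forall>n. x n \<in> S}"

text \<open>In a Wadge game player I plays \<open>y\<close> and player II answers each move at once. A strategy of
  player II that looks at the moves of player I only is the same as a Lipschitz map with constant 1 for the
  usual metric of Baire space.\<close>

definition strategy_map :: "(nat list \<Rightarrow> nat) \<Rightarrow> (nat \<Rightarrow> nat) \<Rightarrow> nat \<Rightarrow> nat" where
  "strategy_map \<sigma> y n = \<sigma> (pre y (Suc n))"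

lemma cont_strategy_map: "cont (strategy_map \<sigma>)"
proof (rule contI)
  fix x n
  show "\<exists>m. \<forall>y. pre y m = pre x m \<longrightarrow> strategy_map \<sigma> y n = strategy_map \<sigma> x n"
    by (intro exI[of _ "Suc n"]) (simp add: strategy_map_def)
qed

definition coord :: "nat \<Rightarrow> (nat \<Rightarrow> nat) \<Rightarrow> nat \<Rightarrow> nat" where
  "coord n x m = x (prod_encode (n, m))"

lemma cont_coord: "cont (coord n)"
proof (rule contI)
  fix x k
  show "\<exists>m. \<forall>y. pre y m = pre x m \<longrightarrow> coord n y k = coord n x k"
    by (intro exI[of _ "Suc (prod_encode (n, k))"]) (simp add: coord_def pre_eq_iff)
qed

text \<open>This is the property behind universal sets: strategies with moves in \<open>S\<close> are coded by points of
  the cube itself, so that the preimages of the labelled sets under all continuous maps are indexed by these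
  points.\<close>

definition universal :: "nat set \<Rightarrow> ((nat \<Rightarrow> nat) \<Rightarrow> 'q) \<Rightarrow> bool" where
  "universal S \<alpha> \<longleftrightarrow> (\<forall>f. cont f \<longrightarrow> (\<exists>\<sigma>. range \<sigma> \<subseteq> S \<and> (\<forall>y. \<alpha> (f y) = \<alpha> (strategy_map \<sigma> y))))"

lemma universal_comp: "universal S \<alpha> \<Longrightarrow> universal S (\<lambda>x. \<Phi> (\<alpha> x))"
  unfolding universal_def by metis

lemma universal_const: "a \<in> S \<Longrightarrow> universal S (\<lambda>x. c)"
  unfolding universal_def by (auto intro: exI[of _ "\<lambda>_. a"])

lemma universal_mono:
  assumes "universal S \<alpha>" "S \<subseteq> T"
  shows "universal T \<alpha>"
  using assms unfolding universal_def by (meson order_trans)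

text \<open>The answer at position \<open>prod_encode (n, m)\<close> is the answer number \<open>m\<close> of the
  strategy \<open>\<sigma> n\<close>.\<close>

definition combine :: "(nat \<Rightarrow> nat list \<Rightarrow> nat) \<Rightarrow> nat list \<Rightarrow> nat" where
  "combine \<sigma> s = (case prod_decode (length s - 1) of (n, m) \<Rightarrow> \<sigma> n (take (Suc m) s))"

lemma coord_strategy_map_combine: "coord n (strategy_map (combine \<sigma>) y) = strategy_map (\<sigma> n) y"
proof
  fix m
  \<comment> \<open>When the answer at this position is due, at least \<open>Suc m\<close> moves of player I are known.\<close>
  have "m \<le> prod_encode (n, m)" by (rule le_prod_encode_2)
  then show "coord n (strategy_map (combine \<sigma>) y) m = strategy_map (\<sigma> n) y m"
    by (simp add: coord_def strategy_map_def combine_def min_def del: take_Suc)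
qed

lemma range_combine: "(\<And>n. range (\<sigma> n) \<subseteq> S) \<Longrightarrow> range (combine \<sigma>) \<subseteq> S"
  by (fastforce simp: combine_def split: prod.splits)

text \<open>Preimages can be computed separately in each coordinate, and the strategies obtained in this way can be
  played simultaneously because a coordinate of a sequence is never ahead of the sequence itself.\<close>

lemma universal_prod:
  assumes "\<And>n. universal S (\<alpha> n)"
  shows "universal S (\<lambda>x n. \<alpha> n (coord n x))"
  unfolding universal_def
proof (intro allI impI)
  fix f assume "cont f"
  then have "cont (\<lambda>y. coord n (f y))" for n
    using cont_comp[OF cont_coord] by blast
  then have "\<forall>n. \<exists>\<sigma>. range \<sigma> \<subseteq> S \<and> (\<forall>y. \<alpha> n (coord n (f y)) = \<alpha> n (strategy_map \<sigma> y))"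
    using assms unfolding universal_def by blast
  then obtain \<sigma> where \<sigma>: "\<And>n. range (\<sigma> n) \<subseteq> S" "\<And>n y. \<alpha> n (coord n (f y)) = \<alpha> n (strategy_map (\<sigma> n) y)"
    by metis
  show "\<exists>\<sigma>. range \<sigma> \<subseteq> S \<and> (\<forall>y. (\<lambda>n. \<alpha> n (coord n (f y))) = (\<lambda>n. \<alpha> n (coord n (strategy_map \<sigma> y))))"
    by (intro exI[of _ "combine \<sigma>"]) (simp add: range_combine \<sigma> coord_strategy_map_combine)
qed

text \<open>This is Cantor's diagonal argument, or the recursion theorem. Let \<open>d y\<close> be the answer to
  \<open>y\<close> of the strategy coded by \<open>y\<close>. If the strategy coded by \<open>c\<close>
  computes the labels \<open>\<alpha> (F (d y))\<close>, then \<open>d c\<close> is the required point.\<close>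

lemma universal_diagonal:
  assumes \<alpha>: "universal S \<alpha>" and F: "cont F"
  shows "\<exists>x\<in>cube S. \<alpha> (F x) = \<alpha> x"
proof -
  define d where "d = (\<lambda>y. strategy_map (\<lambda>l. y (list_encode l)) y)"
  have "cont d"
  proof (rule contI)
    fix x n
    have "d y n = d x n" if "pre y (max (Suc n) (Suc (list_encode (pre x (Suc n))))) =
        pre x (max (Suc n) (Suc (list_encode (pre x (Suc n)))))" for y
    proof -
      have "pre y (Suc n) = pre x (Suc n)" using that by (rule pre_eq_mono) simp
      then show ?thesis using that unfolding d_def strategy_map_def pre_eq_iff[of y "max _ _"] by simp
    qed
    then show "\<exists>m. \<forall>y. pre y m = pre x m \<longrightarrow> d y n = d x n" by blast
  qed
  then have "cont (\<lambda>y. F (d y))" using F cont_comp by blast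
  then obtain \<sigma> where \<sigma>: "range \<sigma> \<subseteq> S" "\<And>y. \<alpha> (F (d y)) = \<alpha> (strategy_map \<sigma> y)"
    using \<alpha> unfolding universal_def by blast
  define c where "c = (\<lambda>n. \<sigma> (list_decode n))"
  have dc: "d c = strategy_map \<sigma> c" by (simp add: d_def c_def)
  have "d c \<in> cube S" unfolding dc using \<sigma>(1) by (auto simp: cube_def strategy_map_def)
  moreover have "\<alpha> (F (d c)) = \<alpha> (d c)" using \<sigma>(2)[of c] dc by simp
  ultimately show ?thesis by blast
qed

section \<open>Closed sets are retracts\<close>

lemma closedin_omega_omega:
  "closedin omega_omega C \<longleftrightarrow> (\<forall>x. (\<forall>n. \<exists>y\<in>C. pre y n = pre x n) \<longrightarrow> x \<in> C)"
proof -
  have "closedin omega_omega C \<longleftrightarrow> openin omega_omega (- C)"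
    by (simp add: closedin_def Compl_eq_Diff_UNIV)
  also have "\<dots> \<longleftrightarrow> (\<forall>x. (\<forall>n. \<exists>y\<in>C. pre y n = pre x n) \<longrightarrow> x \<in> C)"
    unfolding openin_omega_omega by blast
  finally show ?thesis .
qed

text \<open>A sequence outside the closed set is sent to a chosen point of the set that depends only on the longest
  prefix of the sequence which is shared by a point of the set.\<close>

lemma retraction_onto_closed:
  assumes C: "closedin omega_omega C" "C \<noteq> {}"
  obtains R where "cont R" "\<And>x. R x \<in> C" "\<And>x. x \<in> C \<Longrightarrow> R x = x"
proof -
  define p where "p = (\<lambda>s. SOME y. y \<in> C \<and> pre y (length s) = s)"
  have p: "p s \<in> C \<and> pre (p s) (length s) = s" if "y \<in> C" "pre y (length s) = s" for y s
    unfolding p_def using that by (intro someI[of "\<lambda>y. y \<in> C \<and> pre y (length s) = s" y]) blast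
  define good where "good = (\<lambda>x n. \<exists>y\<in>C. pre y n = pre x n)"
  have good0: "good x 0" for x using C(2) by (auto simp: good_def)
  have good_mono: "good x m" if "good x n" "m \<le> n" for x m n
    using that pre_eq_mono unfolding good_def by blast
  define k where "k = (\<lambda>x. GREATEST n. good x n)"
  have kI: "good x (k x)" "\<And>n. good x n \<Longrightarrow> n \<le> k x" if x: "x \<notin> C" for x
  proof -
    obtain N where N: "\<not> good x N" using x C(1) unfolding closedin_omega_omega good_def by blast
    have b: "\<And>n. good x n \<Longrightarrow> n \<le> N" using N good_mono by (meson nat_le_linear)
    show "good x (k x)" unfolding k_def using GreatestI_nat[of "good x", OF good0 b] .
    show "\<And>n. good x n \<Longrightarrow> n \<le> k x" unfolding k_def using Greatest_le_nat[of "good x", OF _ b] .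
  qed
  define R where "R = (\<lambda>x. if x \<in> C then x else p (pre x (k x)))"
  have RC: "R x \<in> C" for x
    using p kI(1)[of x] unfolding R_def good_def by (metis length_pre)
  have Rpre: "pre (R x) n = pre x n" if "good x n" for x n
  proof (cases "x \<in> C")
    case False
    then have "pre (p (pre x (k x))) (k x) = pre x (k x)"
      using p kI(1)[of x] unfolding good_def by (metis length_pre)
    then have "pre (p (pre x (k x))) n = pre x n" using kI(2)[OF False that] by (rule pre_eq_mono)
    then show ?thesis using False by (simp add: R_def)
  qed (simp add: R_def)
  have "cont R"
  proof (rule contI)
    fix x n
    show "\<exists>m. \<forall>y. pre y m = pre x m \<longrightarrow> R y n = R x n"
    proof (cases "x \<in> C")
      case True
      have "R y n = R x n" if "pre y (Suc n) = pre x (Suc n)" for y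
      proof -
        have "good x (Suc n)" "good y (Suc n)" using True that by (auto simp: good_def intro!: bexI[of _ x])
        then have "pre (R y) (Suc n) = pre (R x) (Suc n)" using Rpre that by simp
        then show ?thesis by (simp add: pre_eq_iff)
      qed
      then show ?thesis by blast
    next
      case False
      have "R y = R x" if e: "pre y (Suc (k x)) = pre x (Suc (k x))" for y
      proof -
        have ng: "\<not> good y (Suc (k x))" using kI(2)[OF False, of "Suc (k x)"] e by (auto simp: good_def)
        then have yC: "y \<notin> C" by (auto simp: good_def)
        have e': "pre y (k x) = pre x (k x)" using e by (rule pre_eq_mono) simp
        have "good y (k x)" using kI(1)[OF False] e' by (auto simp: good_def)
        then have "k y = k x" using kI[OF yC] ng good_mono
          by (meson le_antisym not_less_eq_eq)
        then show ?thesis using False yC e' by (simp add: R_def)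
      qed
      then show ?thesis by metis
    qed
  qed
  moreover have "R x = x" if "x \<in> C" for x using that by (simp add: R_def)
  ultimately show ?thesis using RC that by blast
qed

section \<open>Wadge games\<close>

text \<open>What remains of a nice pointclass on Baire space: the closure properties under which the payoff of a Wadge
  game is again determined.\<close>

locale determined_algebra =
  fixes \<S> :: "(nat \<Rightarrow> nat) set set"
  assumes algebra_S: "algebra UNIV \<S>"
    and vimage_S: "\<And>f B. cont f \<Longrightarrow> B \<in> \<S> \<Longrightarrow> {x. f x \<in> B} \<in> \<S>"
    and determined_S: "\<And>B. B \<in> \<S> \<Longrightarrow> determined B"

text \<open>The position reached after player I has made the moves \<open>s\<close> and player II, who moves second, has
  followed \<open>\<tau>\<close>.\<close>

definition hist_II :: "(nat list \<Rightarrow> nat) \<Rightarrow> nat list \<Rightarrow> nat list" where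
  "hist_II \<tau> s = foldl (\<lambda>h a. h @ [a, \<tau> (h @ [a])]) [] s"

text \<open>The position reached after player II has made the moves \<open>s\<close> against player I, who moves first
  and follows \<open>\<tau>\<close>.\<close>

definition hist_I :: "(nat list \<Rightarrow> nat) \<Rightarrow> nat list \<Rightarrow> nat list" where
  "hist_I \<tau> s = foldl (\<lambda>h a. h @ [\<tau> h, a]) [] s"

lemma cont_reindex: "cont (\<lambda>z n. z (k n))"
proof (rule contI)
  fix x :: "nat \<Rightarrow> nat" and n
  show "\<exists>m. \<forall>y. pre y m = pre x m \<longrightarrow> y (k n) = x (k n)"
    by (intro exI[of _ "Suc (k n)"]) (simp add: pre_eq_iff)
qed

lemma pre_double_Suc: "pre z (2 * Suc n) = pre z (2 * n) @ [z (2 * n), z (2 * n + 1)]"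
  by (simp add: pre_Suc)

text \<open>Wadge's lemma. In the game in which player I builds \<open>y\<close>, player II builds \<open>x\<close>, and
  player II wins if \<open>y \<in> B \<longleftrightarrow> x \<in> A\<close>, a winning strategy of either
  player is a continuous reduction; the reduction obtained from player II is even given by a strategy of the
  kind used in \<open>universal\<close>.\<close>

lemma (in determined_algebra) wadge:
  assumes A: "A \<in> \<S>" and B: "B \<in> \<S>"
  shows "(\<exists>\<sigma>. \<forall>y. y \<in> B \<longleftrightarrow> strategy_map \<sigma> y \<in> A) \<or> (\<exists>g. cont g \<and> (\<forall>x. x \<in> A \<longleftrightarrow> g x \<notin> B))"
proof -
  interpret algebra UNIV \<S> by (rule algebra_S)
  define P where "P = {z. (\<lambda>n. z (2 * n)) \<in> B}"
  define Q where "Q = {z. (\<lambda>n. z (2 * n + 1)) \<in> A}"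
  have P: "P \<in> \<S>" unfolding P_def by (rule vimage_S[OF cont_reindex B])
  have Q: "Q \<in> \<S>" unfolding Q_def by (rule vimage_S[OF cont_reindex A])
  define G where "G = (P - Q) \<union> (Q - P)"
  have "G \<in> \<S>" unfolding G_def using P Q by blast
  then have "determined G" by (rule determined_S)
  then consider \<tau> where "wins_I G \<tau>" | \<tau> where "wins_II G \<tau>" unfolding determined_def by blast
  then show ?thesis
  proof cases
    case (1 \<tau>)
    define g where "g = (\<lambda>x n. \<tau> (hist_I \<tau> (pre x n)))"
    have "cont g"
    proof (rule contI)
      fix x n
      show "\<exists>m. \<forall>y. pre y m = pre x m \<longrightarrow> g y n = g x n"
        by (intro exI[of _ n]) (simp add: g_def)
    qed
    moreover have "x \<in> A \<longleftrightarrow> g x \<notin> B" for x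
    proof -
      define z where "z = (\<lambda>k. if even k then g x (k div 2) else x (k div 2))"
      have z: "z (2 * n) = g x n" "z (2 * n + 1) = x n" for n by (simp_all add: z_def)
      have h: "pre z (2 * n) = hist_I \<tau> (pre x n)" for n
      proof (induction n)
        case (Suc n)
        show ?case unfolding pre_double_Suc z Suc by (simp add: pre_Suc hist_I_def g_def)
      qed (simp add: hist_I_def)
      have "z (2 * n) = \<tau> (map z [0..<2 * n])" for n
        using h[of n] by (simp add: z(1) g_def pre_def)
      then have "z \<in> G" using 1 unfolding wins_I_def by blast
      then show ?thesis by (auto simp: G_def P_def Q_def z[simplified])
    qed
    ultimately show ?thesis by blast
  next
    case (2 \<tau>)
    define \<sigma> where "\<sigma> = (\<lambda>s. last (hist_II \<tau> s))"
    have "y \<in> B \<longleftrightarrow> strategy_map \<sigma> y \<in> A" for y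
    proof -
      define z where "z = (\<lambda>k. if even k then y (k div 2) else strategy_map \<sigma> y (k div 2))"
      have z: "z (2 * n) = y n" "z (2 * n + 1) = strategy_map \<sigma> y n" for n by (simp_all add: z_def)
      have \<sigma>: "strategy_map \<sigma> y n = \<tau> (hist_II \<tau> (pre y n) @ [y n])" for n
        by (simp add: strategy_map_def \<sigma>_def pre_Suc hist_II_def)
      have h: "pre z (2 * n) = hist_II \<tau> (pre y n)" for n
      proof (induction n)
        case (Suc n)
        show ?case unfolding pre_double_Suc z Suc \<sigma> by (simp add: pre_Suc hist_II_def)
      qed (simp add: hist_II_def)
      have "z (2 * n + 1) = \<tau> (map z [0..<2 * n + 1])" for n
        using h[of n] unfolding z(2) \<sigma> by (simp add: pre_def z(1))
      then have "z \<notin> G" using 2 unfolding wins_II_def by blast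
      then show ?thesis by (auto simp: G_def P_def Q_def z[simplified])
    qed
    then show ?thesis by blast
  qed
qed

definition proj :: "nat set \<Rightarrow> (nat \<Rightarrow> nat) \<Rightarrow> nat \<Rightarrow> nat" where
  "proj S x n = (if x n \<in> S then x n else 0)"

lemma cont_proj: "cont (proj S)"
proof (rule contI)
  fix x :: "nat \<Rightarrow> nat" and n
  show "\<exists>m. \<forall>y. pre y m = pre x m \<longrightarrow> proj S y n = proj S x n"
    by (intro exI[of _ "Suc n"]) (simp add: pre_eq_iff proj_def)
qed

lemma proj_cube: "x \<in> cube S \<Longrightarrow> proj S x = x"
  by (auto simp: cube_def proj_def)

lemma proj_in_cube: "0 \<in> S \<Longrightarrow> proj S x \<in> cube S"
  by (auto simp: cube_def proj_def)

lemma proj_UNIV [simp]: "proj UNIV x = x"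
  by (auto simp: proj_def)

definition self_dual :: "(nat \<Rightarrow> nat) set \<Rightarrow> bool" where
  "self_dual A \<longleftrightarrow> (\<exists>g. cont g \<and> (\<forall>x. x \<in> A \<longleftrightarrow> g x \<notin> A))"

text \<open>If \<open>A\<close> is not selfdual, then player I cannot win the Wadge game for a set \<open>B\<close> that
  is reducible to \<open>A\<close>, since that would reduce \<open>A\<close> to the complement of
  \<open>B\<close> and thus to its own complement. Invariance under the projection onto the cube allows
  replacing illegal moves by \<open>0\<close>.\<close>

lemma (in determined_algebra) universal_if_not_self_dual:
  assumes A: "A \<in> \<S>" "\<not> self_dual A" and S: "0 \<in> S" and inv: "\<And>x. proj S x \<in> A \<longleftrightarrow> x \<in> A"
  shows "universal S (\<lambda>x. x \<in> A)"
  unfolding universal_def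
proof (intro allI impI)
  fix f assume f: "cont f"
  have "\<not> (\<exists>g. cont g \<and> (\<forall>x. x \<in> A \<longleftrightarrow> g x \<notin> {y. f y \<in> A}))"
  proof
    assume "\<exists>g. cont g \<and> (\<forall>x. x \<in> A \<longleftrightarrow> g x \<notin> {y. f y \<in> A})"
    then obtain g where "cont g" "\<forall>x. x \<in> A \<longleftrightarrow> f (g x) \<notin> A" by auto
    then show False using A(2) cont_comp[OF f] unfolding self_dual_def by blast
  qed
  then obtain \<sigma> where \<sigma>: "\<And>y. y \<in> {y. f y \<in> A} \<longleftrightarrow> strategy_map \<sigma> y \<in> A"
    using wadge[OF A(1) vimage_S[OF f A(1)]] by blast
  define \<sigma>' where "\<sigma>' = (\<lambda>s. if \<sigma> s \<in> S then \<sigma> s else 0)"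
  have "strategy_map \<sigma>' y = proj S (strategy_map \<sigma> y)" for y by (auto simp: strategy_map_def proj_def \<sigma>'_def)
  then have "(f y \<in> A) = (strategy_map \<sigma>' y \<in> A)" for y using \<sigma>[of y] inv by simp
  moreover have "range \<sigma>' \<subseteq> S" using S by (auto simp: \<sigma>'_def)
  ultimately show "\<exists>\<sigma>. range \<sigma> \<subseteq> S \<and> (\<forall>y. (f y \<in> A) = (strategy_map \<sigma> y \<in> A))" by blast
qed

section \<open>Gluing continuous maps\<close>

lemma cont_glue:
  assumes "\<And>x. \<exists>m g. cont g \<and> (\<forall>y. pre y m = pre x m \<longrightarrow> f y = g y)"
  shows "cont f"
proof (rule contI)
  fix x n
  obtain m g where g: "cont g" "\<And>y. pre y m = pre x m \<Longrightarrow> f y = g y" using assms by blast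
  obtain k where k: "\<And>y. pre y k = pre x k \<Longrightarrow> g y n = g x n" using g(1) unfolding cont_iff by blast
  have "f y n = f x n" if "pre y (max m k) = pre x (max m k)" for y
    using k[of y] g(2)[of y] g(2)[of x] pre_eq_mono[OF that, of m] pre_eq_mono[OF that, of k] by simp
  then show "\<exists>m. \<forall>y. pre y m = pre x m \<longrightarrow> f y n = f x n" by blast
qed

text \<open>Picking the shortest prefix with property \<open>P\<close> partitions the open set of all sequences with
  such a prefix into basic clopen sets.\<close>

definition first_prefix :: "(nat list \<Rightarrow> bool) \<Rightarrow> (nat \<Rightarrow> nat) \<Rightarrow> nat list" where
  "first_prefix P x = pre x (LEAST n. P (pre x n))"

lemma first_prefix:
  assumes "P (pre x n)"
  shows "P (first_prefix P x)" and "pre x (length (first_prefix P x)) = first_prefix P x"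
  using assms unfolding first_prefix_def by (auto intro: LeastI)

lemma first_prefix_cong:
  assumes P: "P (pre x n)"
    and y: "pre y (length (first_prefix P x)) = pre x (length (first_prefix P x))"
  shows "first_prefix P y = first_prefix P x"
proof -
  let ?N = "LEAST n. P (pre x n)"
  have e: "pre y ?N = pre x ?N" using y by (simp add: first_prefix_def)
  have "(LEAST n. P (pre y n)) = ?N"
  proof (rule Least_equality)
    show "P (pre y ?N)" unfolding e using P by (rule LeastI)
    fix k assume k: "P (pre y k)"
    show "?N \<le> k"
    proof (rule ccontr)
      assume "\<not> ?N \<le> k"
      then have "P (pre x k)" "k < ?N" using k pre_eq_mono[OF e, of k] by auto
      then show False using not_less_Least by blast
    qed
  qed
  then show ?thesis using e by (simp add: first_prefix_def)
qed

definition pair :: "(nat \<Rightarrow> nat) \<Rightarrow> (nat \<Rightarrow> nat) \<Rightarrow> nat \<Rightarrow> nat" where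
  "pair x y k = (case prod_decode k of (n, m) \<Rightarrow> if n = 0 then x m else y m)"

lemma coord_pair [simp]: "coord 0 (pair x y) = x" "coord (Suc n) (pair x y) = y"
  by (auto simp: coord_def pair_def)

lemma cont_pair:
  assumes "cont f" "cont g"
  shows "cont (\<lambda>x. pair (f x) (g x))"
proof (rule contI)
  fix x k
  obtain n m where k: "prod_decode k = (n, m)" by fastforce
  show "\<exists>l. \<forall>y. pre y l = pre x l \<longrightarrow> pair (f y) (g y) k = pair (f x) (g x) k"
    using assms unfolding cont_iff by (cases "n = 0") (simp_all add: pair_def k)
qed

lemma coord_proj: "coord n (proj S x) = proj S (coord n x)"
  by (auto simp: coord_def proj_def)

text \<open>A closed set of sequences is compact if and only if it is bounded in each coordinate, so for closed
  \<open>F\<close> this says that the part of \<open>F\<close> above \<open>s\<close> is compact.\<close>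

definition bounded_piece :: "(nat \<Rightarrow> nat) set \<Rightarrow> nat list \<Rightarrow> bool" where
  "bounded_piece F s \<longleftrightarrow> (\<exists>b. \<forall>x\<in>F. pre x (length s) = s \<longrightarrow> (\<forall>i. x i \<le> b i))"

text \<open>Unary notation, which embeds Baire space in Cantor space. On a bounded set of sequences it is inverted by
  \<open>count_unary b\<close>, a map that is continuous on the whole space. In this way bounded closed sets
  become retracts of Cantor space.\<close>

definition unary :: "(nat \<Rightarrow> nat) \<Rightarrow> nat \<Rightarrow> nat" where
  "unary x k = (case prod_decode k of (i, j) \<Rightarrow> of_bool (j < x i))"

definition count_unary :: "(nat \<Rightarrow> nat) \<Rightarrow> (nat \<Rightarrow> nat) \<Rightarrow> nat \<Rightarrow> nat" where
  "count_unary b w i = card {j. j < b i \<and> w (prod_encode (i, j)) = 1}"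

lemma cont_unary: "cont unary"
proof (rule contI)
  fix x k
  obtain i j where k: "prod_decode k = (i, j)" by fastforce
  show "\<exists>m. \<forall>y. pre y m = pre x m \<longrightarrow> unary y k = unary x k"
    by (intro exI[of _ "Suc i"]) (simp add: unary_def k pre_eq_iff)
qed

lemma unary_in_cube: "unary x \<in> cube {0, 1}"
  by (auto simp: cube_def unary_def split: prod.splits)

lemma cont_count_unary: "cont (count_unary b)"
proof (rule contI)
  fix x i
  let ?M = "Suc (\<Sum>j<b i. prod_encode (i, j))"
  have "count_unary b y i = count_unary b x i" if "pre y ?M = pre x ?M" for y
  proof -
    have "prod_encode (i, j) < ?M" if "j < b i" for j
      using member_le_sum[of j "{..<b i}" "\<lambda>j. prod_encode (i, j)"] that by simp
    then have "y (prod_encode (i, j)) = x (prod_encode (i, j))" if "j < b i" for j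
      using that \<open>pre y ?M = pre x ?M\<close> unfolding pre_eq_iff by blast
    then have "{j. j < b i \<and> y (prod_encode (i, j)) = 1} = {j. j < b i \<and> x (prod_encode (i, j)) = 1}"
      by auto
    then show ?thesis by (simp add: count_unary_def)
  qed
  then show "\<exists>m. \<forall>y. pre y m = pre x m \<longrightarrow> count_unary b y i = count_unary b x i" by blast
qed

lemma count_unary_unary:
  assumes "\<And>i. x i \<le> b i"
  shows "count_unary b (unary x) = x"
proof
  fix i
  have "{j. j < b i \<and> unary x (prod_encode (i, j)) = 1} = {..<x i}"
    using assms[of i] by (auto simp: unary_def)
  then show "count_unary b (unary x) i = x i" by (simp add: count_unary_def)
qed

text \<open>The sequences \<open>spike m x\<close> form countably many disjoint copies of Baire space that shrink to the
  zero sequence as \<open>m\<close> grows, like a one-point compactification of their sum.\<close>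

definition spike :: "nat \<Rightarrow> (nat \<Rightarrow> nat) \<Rightarrow> nat \<Rightarrow> nat" where
  "spike m x j = (if j < m then 0 else if j = m then 1 else x (j - Suc m))"

lemma cont_spike: "cont (spike m)"
proof (rule contI)
  fix x n
  show "\<exists>k. \<forall>y. pre y k = pre x k \<longrightarrow> spike m y n = spike m x n"
    by (intro exI[of _ "Suc (n - Suc m)"]) (simp add: pre_eq_iff spike_def)
qed

text \<open>A map on pairs \<open>(w, p)\<close>, where \<open>p\<close> is zero or a spike. It is the projection to
  \<open>w\<close> at the zero sequence and \<open>G m\<close> on the copy number \<open>m\<close>, with a
  parameter that consists of the first \<open>m\<close> entries of \<open>w\<close>.\<close>

definition spike_glue :: "(nat \<Rightarrow> nat list \<Rightarrow> (nat \<Rightarrow> nat) \<Rightarrow> (nat \<Rightarrow> nat)) \<Rightarrow>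
    (nat \<Rightarrow> nat) \<Rightarrow> (nat \<Rightarrow> nat) \<Rightarrow> nat \<Rightarrow> nat" where
  "spike_glue G w p = (if \<forall>j. p j = 0 then w else
     (let m = (LEAST j. p j \<noteq> 0) in G m (pre w m) (\<lambda>j. p (j + Suc m))))"

lemma spike_glue_zero: "spike_glue G w (\<lambda>j. 0) = w"
  by (simp add: spike_glue_def)

lemma Least_first:
  fixes p :: "nat \<Rightarrow> nat"
  assumes "p m \<noteq> 0" "\<And>j. j < m \<Longrightarrow> p j = 0"
  shows "(LEAST j. p j \<noteq> 0) = m"
  using assms by (intro Least_equality) (auto simp: not_less[symmetric])

lemma spike_glue_spike: "spike_glue G w (spike m x) = G m (pre w m) x"
proof -
  have "(LEAST j. spike m x j \<noteq> 0) = m" by (rule Least_first) (auto simp: spike_def)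
  moreover have "(\<lambda>j. spike m x (j + Suc m)) = x" by (auto simp: spike_def)
  moreover have "\<not> (\<forall>j. spike m x j = 0)" by (auto simp: spike_def intro!: exI[of _ m])
  ultimately show ?thesis unfolding spike_glue_def Let_def by auto
qed

text \<open>The only critical points are those with \<open>q x = 0\<close>. A nearby spike has a large index
  \<open>m\<close>, and there \<open>G m\<close> takes values that share the first \<open>m\<close> entries
  with \<open>u x\<close>.\<close>

lemma cont_spike_glue:
  assumes u: "cont u" and q: "cont q"
    and G: "\<And>x m. cont (G m (pre (u x) m))"
    and Gpre: "\<And>x m y. pre (G m (pre (u x) m) y) m = pre (u x) m"
  shows "cont (\<lambda>x. spike_glue G (u x) (q x))"
proof (rule contI)
  fix x n
  show "\<exists>k. \<forall>y. pre y k = pre x k \<longrightarrow> spike_glue G (u y) (q y) n = spike_glue G (u x) (q x) n"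
  proof (cases "\<forall>j. q x j = 0")
    case True
    then have x: "spike_glue G (u x) (q x) = u x" by (simp add: spike_glue_def)
    obtain k1 where k1: "\<And>y. pre y k1 = pre x k1 \<Longrightarrow> pre (u y) (Suc n) = pre (u x) (Suc n)"
      using cont_pre[OF u] by blast
    obtain k2 where k2: "\<And>y. pre y k2 = pre x k2 \<Longrightarrow> pre (q y) (Suc n) = pre (q x) (Suc n)"
      using cont_pre[OF q] by blast
    have "spike_glue G (u y) (q y) n = u x n" if e: "pre y (max k1 k2) = pre x (max k1 k2)" for y
    proof -
      have uy: "u y n = u x n" using k1[OF pre_eq_mono[OF e]] by (simp add: pre_eq_iff)
      have qy: "q y j = 0" if "j \<le> n" for j
        using k2[OF pre_eq_mono[OF e]] True that by (simp add: pre_eq_iff)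
      show ?thesis
      proof (cases "\<forall>j. q y j = 0")
        case False
        define m where "m = (LEAST j. q y j \<noteq> 0)"
        have "q y m \<noteq> 0" unfolding m_def by (rule LeastI_ex) (use False in blast)
        then have "n < m" using qy not_less by blast
        then have "G m (pre (u y) m) p n = u y n" for p
          using Gpre[of m y p] by (simp add: pre_eq_iff)
        then show ?thesis using False uy unfolding spike_glue_def Let_def m_def[symmetric] by simp
      qed (simp add: spike_glue_def uy)
    qed
    then show ?thesis using x by metis
  next
    case False
    define m where "m = (LEAST j. q x j \<noteq> 0)"
    have m: "q x m \<noteq> 0" unfolding m_def by (rule LeastI_ex) (use False in blast)
    have m': "q x j = 0" if "j < m" for j using that not_less_Least unfolding m_def by blast
    define g where "g = (\<lambda>y. G m (pre (u x) m) (\<lambda>j. q y (j + Suc m)))"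
    have "cont g" unfolding g_def
      by (rule cont_comp[OF G cont_comp[OF cont_reindex q]])
    then obtain k0 where k0: "\<And>y. pre y k0 = pre x k0 \<Longrightarrow> g y n = g x n"
      unfolding cont_iff by blast
    obtain k1 where k1: "\<And>y. pre y k1 = pre x k1 \<Longrightarrow> pre (u y) m = pre (u x) m"
      using cont_pre[OF u] by blast
    obtain k2 where k2: "\<And>y. pre y k2 = pre x k2 \<Longrightarrow> pre (q y) (Suc m) = pre (q x) (Suc m)"
      using cont_pre[OF q] by blast
    have gy: "spike_glue G (u y) (q y) = g y" if "pre y k1 = pre x k1" "pre y k2 = pre x k2" for y
    proof -
      have qy: "q y j = q x j" if "j \<le> m" for j
        using k2[OF \<open>pre y k2 = pre x k2\<close>] that by (simp add: pre_eq_iff)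
      have "(LEAST j. q y j \<noteq> 0) = m" by (rule Least_first) (use qy m m' in auto)
      moreover have "\<not> (\<forall>j. q y j = 0)" using qy[of m] m by (metis order_refl)
      ultimately show ?thesis
        unfolding spike_glue_def Let_def g_def by (simp only: k1[OF that(1)] if_False)
    qed
    show ?thesis
    proof (intro exI allI impI)
      fix y assume e: "pre y (max k0 (max k1 k2)) = pre x (max k0 (max k1 k2))"
      have "spike_glue G (u y) (q y) = g y" by (intro gy) (rule pre_eq_mono[OF e], simp)+
      moreover have "g y n = g x n" by (intro k0) (rule pre_eq_mono[OF e], simp)
      ultimately show "spike_glue G (u y) (q y) n = spike_glue G (u x) (q x) n" using gy[of x] by simp
    qed
  qed
qed


section \<open>Wadge representatives in Cantor space\<close>

text \<open>Let \<open>\<G>\<close> be the class of all continuous preimages of \<open>A\<close> in Cantor space. If some \<open>B \<in> \<G>\<close> has a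
  complement outside \<open>\<G>\<close>, then Wadge's lemma reduces \<open>A\<close> to \<open>B\<close>, as desired. So suppose that \<open>\<G>\<close> is
  closed under complements. Call a set \<open>Y\<close> small if the part of \<open>A\<close> in \<open>Y\<close> is reducible to some \<open>B \<in> \<G>\<close>. Let \<open>F\<close> be
  the set of points of \<open>X\<close> without small neighbourhood. If \<open>F\<close> is empty, then local reductions of \<open>A\<close> to its
  complement can be glued, and \<open>A\<close> is selfdual. Otherwise some basic clopen set \<open>Y\<close> cuts a non-empty
  compact piece \<open>K\<close> out of \<open>F\<close>. The rest of \<open>Y\<close> splits into small pieces with representatives in \<open>\<G>\<close>.
  By Wadge's lemma each of these representatives is reducible to \<open>A\<close> in every neighbourhood of every point of
  \<open>F\<close>. Hence copies of them can be attached to \<open>K\<close>, shrinking towards \<open>K\<close>, in such a way that the result is a compact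
  space with a subset in \<open>\<G>\<close> to which \<open>A\<close> is reducible on \<open>Y\<close>. Then \<open>Y\<close> is small although it
  meets \<open>F\<close>, a contradiction.\<close>

theorem (in determined_algebra) cantor_representation:
  assumes A: "A \<in> \<S>" "\<not> self_dual A"
    and X: "closedin omega_omega X" and R: "cont R" "\<And>x. R x \<in> X" "\<And>x. x \<in> X \<Longrightarrow> R x = x" "\<And>x. R x \<in> A \<longleftrightarrow> x \<in> A"
    and bdd: "\<And>F. F \<subseteq> X \<Longrightarrow> closedin omega_omega F \<Longrightarrow> F \<noteq> {} \<Longrightarrow> \<exists>z\<in>F. \<exists>n. bounded_piece F (pre z n)"
  shows "\<exists>f h. cont f \<and> cont h \<and> (\<forall>x. x \<in> A \<longleftrightarrow> h (proj {0,1} (f x)) \<in> A)"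
proof -
  let ?\<rho> = "proj {0,1}"
  have \<rho>\<rho>: "?\<rho> (?\<rho> x) = ?\<rho> x" for x by (rule proj_cube[OF proj_in_cube]) simp
  have "\<exists>h. cont h \<and> \<not> (\<exists>k. cont k \<and> (\<forall>y. h (?\<rho> y) \<in> A \<longleftrightarrow> k (?\<rho> y) \<notin> A))"
  proof (rule ccontr)
    assume "\<not> ?thesis"
    then have SD: "\<exists>k. cont k \<and> (\<forall>y. h (?\<rho> y) \<in> A \<longleftrightarrow> k (?\<rho> y) \<notin> A)" if "cont h" for h
      using that by blast
    define nb where "nb = (\<lambda>s. {y \<in> X. pre y (length s) = s})"
    define small where "small = (\<lambda>Y. \<exists>h \<phi>. cont h \<and> cont \<phi> \<and> (\<forall>y\<in>Y. y \<in> A \<longleftrightarrow> h (?\<rho> (\<phi> y)) \<in> A))"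
    define sm where "sm = (\<lambda>s. small (nb s))"
    define F where "F = {z \<in> X. \<forall>n. \<not> sm (pre z n)}"
    have nb_closed: "closedin omega_omega (nb s)" for s
      unfolding closedin_omega_omega
    proof (intro allI impI)
      fix x assume *: "\<forall>n. \<exists>y\<in>nb s. pre y n = pre x n"
      then have "x \<in> X" using X unfolding closedin_omega_omega nb_def by blast
      moreover have "pre x (length s) = s" using *[rule_format, of "length s"] by (auto simp: nb_def)
      ultimately show "x \<in> nb s" by (simp add: nb_def)
    qed
    have F_closed: "closedin omega_omega F"
      unfolding closedin_omega_omega
    proof (intro allI impI)
      fix x assume *: "\<forall>n. \<exists>y\<in>F. pre y n = pre x n"
      then have "x \<in> X" using X unfolding closedin_omega_omega F_def by blast
      moreover have "\<not> sm (pre x n)" for n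
      proof -
        obtain y where "y \<in> F" "pre y n = pre x n" using * by blast
        then show ?thesis unfolding F_def by (metis (mono_tags, lifting) mem_Collect_eq)
      qed
      ultimately show "x \<in> F" by (simp add: F_def)
    qed
    have "\<exists>h \<phi>. cont h \<and> cont \<phi> \<and> (sm s \<longrightarrow> (\<forall>y\<in>nb s. y \<in> A \<longleftrightarrow> h (?\<rho> (\<phi> y)) \<in> A))" for s
      using cont_id unfolding sm_def small_def by blast
    then obtain H \<Phi> where H: "\<And>s. cont (H s)" and \<Phi>: "\<And>s. cont (\<Phi> s)"
      and H\<Phi>: "\<And>s y. sm s \<Longrightarrow> y \<in> nb s \<Longrightarrow> y \<in> A \<longleftrightarrow> H s (?\<rho> (\<Phi> s y)) \<in> A"
      by metis
    define fp where "fp = first_prefix sm"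
    have fp: "sm (fp y)" "y \<in> nb (fp y)" if y: "y \<in> X" "y \<notin> F" for y
    proof -
      obtain n where "sm (pre y n)" using y by (auto simp: F_def)
      then show "sm (fp y)" "y \<in> nb (fp y)" unfolding fp_def nb_def using first_prefix y by auto
    qed
    have fp_cong: "fp y' = fp y" if y: "y \<in> X" "y \<notin> F" "pre y' (length (fp y)) = pre y (length (fp y))" for y y'
    proof -
      obtain n where "sm (pre y n)" using y by (auto simp: F_def)
      then show ?thesis using y(3) unfolding fp_def by (rule first_prefix_cong)
    qed
    have "F \<noteq> {}"
    proof
      assume F: "F = {}"
      obtain K where K: "\<And>s. cont (K s)" "\<And>s y. H s (?\<rho> y) \<in> A \<longleftrightarrow> K s (?\<rho> y) \<notin> A"
        using SD[OF H] by metis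
      define g where "g = (\<lambda>y. K (fp (R y)) (?\<rho> (\<Phi> (fp (R y)) (R y))))"
      have "cont g"
      proof (rule cont_glue)
        fix x
        let ?s = "fp (R x)"
        obtain m where m: "\<And>y. pre y m = pre x m \<Longrightarrow> pre (R y) (length ?s) = pre (R x) (length ?s)"
          using cont_pre[OF R(1)] by blast
        have "cont (\<lambda>y. K ?s (?\<rho> (\<Phi> ?s (R y))))"
          by (intro cont_comp[OF K(1)] cont_comp[OF cont_proj] cont_comp[OF \<Phi>] R(1))
        moreover have "g y = K ?s (?\<rho> (\<Phi> ?s (R y)))" if "pre y m = pre x m" for y
          using fp_cong[OF R(2) _ m[OF that]] F by (simp add: g_def)
        ultimately show "\<exists>m g'. cont g' \<and> (\<forall>y. pre y m = pre x m \<longrightarrow> g y = g' y)" by blast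
      qed
      moreover have "x \<in> A \<longleftrightarrow> g x \<notin> A" for x
        using H\<Phi>[OF fp[OF R(2)], of x] F K(2) R(4)[of x] by (simp add: g_def)
      ultimately show False using A(2) unfolding self_dual_def by blast
    qed
    then obtain z n0 b where z: "z \<in> F" and b: "\<And>x i. x \<in> F \<Longrightarrow> pre x n0 = pre z n0 \<Longrightarrow> x i \<le> b i"
      using bdd[OF _ F_closed] unfolding F_def bounded_piece_def by (metis (no_types, lifting) length_pre mem_Collect_eq subsetI)
    \<comment> \<open>Wadge's lemma for \<open>A\<close> on a neighbourhood of \<open>k\<close> and the complement of a member
      of \<open>\<G>\<close>; the other alternative would make that neighbourhood small.\<close>
    have reach: "\<exists>g. cont g \<and> (\<forall>y. h (?\<rho> y) \<in> A \<longleftrightarrow> g y \<in> A) \<and> (\<forall>y. g y \<in> nb (pre k n))"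
      if k: "k \<in> F" and h: "cont h" for k n h
    proof -
      have "k \<in> nb (pre k n)" using k by (simp add: nb_def F_def)
      then obtain R' where R': "cont R'" "\<And>x. R' x \<in> nb (pre k n)" "\<And>x. x \<in> nb (pre k n) \<Longrightarrow> R' x = x"
        using retraction_onto_closed[OF nb_closed] by blast
      obtain l where l: "cont l" "\<And>y. h (?\<rho> y) \<in> A \<longleftrightarrow> l (?\<rho> y) \<notin> A" using SD[OF h] by blast
      have 1: "{y. l (?\<rho> y) \<in> A} \<in> \<S>" by (rule vimage_S[OF cont_comp[OF l(1) cont_proj] A(1)])
      have 2: "{x. R' x \<in> A} \<in> \<S>" by (rule vimage_S[OF R'(1) A(1)])
      have "\<not> (\<exists>\<sigma>. \<forall>y. y \<in> {x. R' x \<in> A} \<longleftrightarrow> strategy_map \<sigma> y \<in> {y. l (?\<rho> y) \<in> A})"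
      proof
        assume "\<exists>\<sigma>. \<forall>y. y \<in> {x. R' x \<in> A} \<longleftrightarrow> strategy_map \<sigma> y \<in> {y. l (?\<rho> y) \<in> A}"
        then obtain \<sigma> where "\<And>y. R' y \<in> A \<longleftrightarrow> l (?\<rho> (strategy_map \<sigma> y)) \<in> A" by auto
        then have "\<forall>y\<in>nb (pre k n). y \<in> A \<longleftrightarrow> l (?\<rho> (strategy_map \<sigma> y)) \<in> A" using R'(3) by metis
        then have "sm (pre k n)" unfolding sm_def small_def using l(1) cont_strategy_map by blast
        then show False using k by (simp add: F_def)
      qed
      then obtain g where "cont g" "\<And>x. l (?\<rho> x) \<in> A \<longleftrightarrow> R' (g x) \<notin> A"
        using wadge[OF 1 2] by auto
      then show ?thesis using l(2) R' cont_comp[OF R'(1)] by blast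
    qed
    define K where "K = {x \<in> F. pre x n0 = pre z n0}"
    have KF: "K \<subseteq> F" by (auto simp: K_def)
    have "closedin omega_omega K"
      unfolding closedin_omega_omega
    proof (intro allI impI)
      fix x assume *: "\<forall>n. \<exists>y\<in>K. pre y n = pre x n"
      then have "x \<in> F" using F_closed unfolding closedin_omega_omega K_def by blast
      moreover have "pre x n0 = pre z n0" using *[rule_format, of n0] by (auto simp: K_def)
      ultimately show "x \<in> K" by (simp add: K_def)
    qed
    moreover have "z \<in> K" using z by (simp add: K_def)
    ultimately obtain RK where RK: "cont RK" "\<And>x. RK x \<in> K" "\<And>x. x \<in> K \<Longrightarrow> RK x = x"
      using retraction_onto_closed by blast
    have "z \<in> nb (pre z n0)" using z by (simp add: nb_def F_def)
    then obtain RY where RY: "cont RY" "\<And>x. RY x \<in> nb (pre z n0)" "\<And>x. x \<in> nb (pre z n0) \<Longrightarrow> RY x = x"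
      using retraction_onto_closed[OF nb_closed] by blast
    have "\<exists>g. k \<in> F \<longrightarrow> cont g \<and> (\<forall>y. H s (?\<rho> y) \<in> A \<longleftrightarrow> g y \<in> A) \<and> (\<forall>y. g y \<in> nb (pre k n))" for s k n
      using reach[OF _ H] by blast
    then have "\<forall>s t. \<exists>g. t \<in> {pre k n | k n. k \<in> F} \<longrightarrow>
        cont g \<and> (\<forall>y. H s (?\<rho> y) \<in> A \<longleftrightarrow> g y \<in> A) \<and> (\<forall>y. g y \<in> nb t)"
      by blast
    then obtain G where "\<And>s t. t \<in> {pre k n | k n. k \<in> F} \<Longrightarrow>
        cont (G s t) \<and> (\<forall>y. H s (?\<rho> y) \<in> A \<longleftrightarrow> G s t y \<in> A) \<and> (\<forall>y. G s t y \<in> nb t)"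
      unfolding choice_iff by blast
    then have G: "\<And>s k n. k \<in> F \<Longrightarrow> cont (G s (pre k n))"
      "\<And>s k n y. k \<in> F \<Longrightarrow> H s (?\<rho> y) \<in> A \<longleftrightarrow> G s (pre k n) y \<in> A"
      "\<And>s k n y. k \<in> F \<Longrightarrow> G s (pre k n) y \<in> nb (pre k n)"
      by blast+
    \<comment> \<open>A continuous map of Cantor space onto the compact set \<open>K\<close>, with right inverse
      \<open>unary\<close>.\<close>
    define u where "u = (\<lambda>w. RK (count_unary b w))"
    have u: "cont u" unfolding u_def by (rule cont_comp[OF RK(1) cont_count_unary])
    have uK: "u w \<in> K" for w by (simp add: u_def RK(2))
    have uv: "u (unary x) = x" if "x \<in> K" for x
      using count_unary_unary[of x b] b that RK(3) by (simp add: u_def K_def)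
    \<comment> \<open>On \<open>Y\<close>, the set \<open>A\<close> will be reduced to its own preimage under
      \<open>h\<close>. Coordinate \<open>0\<close> codes a point of \<open>K\<close>, coordinate
      \<open>1\<close> is zero on \<open>K\<close> itself and a spike in an attached copy; the index of
      the spike codes the small piece.\<close>
    define h where "h = (\<lambda>x. spike_glue (\<lambda>m. G (list_decode m)) (u (coord 0 x)) (coord 1 x))"
    have h: "cont h"
      unfolding h_def
    proof (rule cont_spike_glue)
      show "cont (\<lambda>x. u (coord 0 x))" by (rule cont_comp[OF u cont_coord])
      show "cont (coord 1)" by (rule cont_coord)
      fix x m y
      have uF: "u (coord 0 x) \<in> F" using uK KF by blast
      show "cont (G (list_decode m) (pre (u (coord 0 x)) m))" by (rule G(1)[OF uF])
      show "pre (G (list_decode m) (pre (u (coord 0 x)) m) y) m = pre (u (coord 0 x)) m"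
        using G(3)[OF uF, of "list_decode m" m y] by (simp add: nb_def)
    qed
    define tail where "tail = (\<lambda>y. if y \<in> F then (\<lambda>j. 0) else spike (list_encode (fp y)) (\<Phi> (fp y) y))"
    define \<phi> where "\<phi> = (\<lambda>y. pair (unary (RK (RY y))) (tail (RY y)))"
    have RYX: "RY y \<in> X" for y using RY(2)[of y] by (simp add: nb_def)
    have tail: "cont (\<lambda>y. tail (RY y))"
    proof (rule contI)
      fix x n
      show "\<exists>m. \<forall>y. pre y m = pre x m \<longrightarrow> tail (RY y) n = tail (RY x) n"
      proof (cases "RY x \<in> F")
        case True
        define N where "N = Max ((\<lambda>m. length (list_decode m)) ` {..n})"
        have N: "length (list_decode m) \<le> N" if "m \<le> n" for m
          unfolding N_def using that by (intro Max_ge) auto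
        obtain m where m: "\<And>y. pre y m = pre x m \<Longrightarrow> pre (RY y) N = pre (RY x) N"
          using cont_pre[OF RY(1)] by blast
        \<comment> \<open>Near a point of \<open>F\<close> only pieces with large code occur, because each of the finitely
          many prefixes with code at most \<open>n\<close> either leads away from that point or does
          not determine a small neighbourhood.\<close>
        have "tail (RY y) n = 0" if "pre y m = pre x m" for y
        proof (cases "RY y \<in> F")
          case False
          let ?s = "fp (RY y)"
          have s: "sm ?s" "pre (RY y) (length ?s) = ?s" using fp[OF RYX False] by (auto simp: nb_def)
          have "n < list_encode ?s"
          proof (rule ccontr)
            assume "\<not> n < list_encode ?s"
            then have "length ?s \<le> N" using N[of "list_encode ?s"] by simp
            then have "pre (RY x) (length ?s) = ?s" using m[OF that] s(2) pre_eq_mono by metis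
            then have "sm (pre (RY x) (length ?s))" using s(1) by simp
            then show False using True unfolding F_def by blast
          qed
          then show ?thesis using False by (simp add: tail_def spike_def)
        qed (simp add: tail_def)
        moreover have "tail (RY x) n = 0" using True by (simp add: tail_def)
        ultimately show ?thesis by (intro exI[of _ m]) simp
      next
        case False
        let ?s = "fp (RY x)"
        obtain m where m: "\<And>y. pre y m = pre x m \<Longrightarrow> pre (RY y) (length ?s) = pre (RY x) (length ?s)"
          using cont_pre[OF RY(1)] by blast
        have "cont (\<lambda>y. spike (list_encode ?s) (\<Phi> ?s (RY y)))"
          by (intro cont_comp[OF cont_spike] cont_comp[OF \<Phi>] RY(1))
        then obtain k where k: "\<And>y. pre y k = pre x k \<Longrightarrow>
            spike (list_encode ?s) (\<Phi> ?s (RY y)) n = spike (list_encode ?s) (\<Phi> ?s (RY x)) n"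
          unfolding cont_iff by blast
        have e: "tail (RY y) = spike (list_encode ?s) (\<Phi> ?s (RY y))" if "pre y m = pre x m" for y
        proof -
          have "fp (RY y) = ?s" by (rule fp_cong[OF RYX False m[OF that]])
          moreover have "RY y \<notin> F"
          proof
            assume "RY y \<in> F"
            moreover have "pre (RY y) (length ?s) = ?s" "sm ?s"
              using fp[OF RYX False] m[OF that] by (auto simp: nb_def)
            ultimately show False unfolding F_def by (metis (mono_tags, lifting) mem_Collect_eq)
          qed
          ultimately show ?thesis by (simp add: tail_def)
        qed
        have "tail (RY y) n = tail (RY x) n" if y: "pre y (max m k) = pre x (max m k)" for y
        proof -
          have "tail (RY y) = spike (list_encode ?s) (\<Phi> ?s (RY y))"
            by (rule e) (rule pre_eq_mono[OF y], simp)
          moreover have "pre y k = pre x k" by (rule pre_eq_mono[OF y]) simp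
          ultimately show ?thesis using k[of y] e[of x] by simp
        qed
        then show ?thesis by blast
      qed
    qed
    have \<phi>: "cont \<phi>" unfolding \<phi>_def
      by (intro cont_pair tail cont_comp[OF cont_unary] cont_comp[OF RK(1)] RY(1))
    have "y \<in> A \<longleftrightarrow> h (?\<rho> (\<phi> y)) \<in> A" if y: "y \<in> nb (pre z n0)" for y
    proof -
      have 0: "coord 0 (?\<rho> (\<phi> y)) = unary (RK y)"
        using y by (simp add: coord_proj \<phi>_def RY(3) proj_cube[OF unary_in_cube, simplified])
      have 1: "coord 1 (?\<rho> (\<phi> y)) = ?\<rho> (tail y)"
        using y by (simp add: coord_proj \<phi>_def RY(3))
      have hy: "h (?\<rho> (\<phi> y)) = spike_glue (\<lambda>m. G (list_decode m)) (RK y) (?\<rho> (tail y))"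
        unfolding h_def 0 1 by (simp add: uv RK(2))
      show ?thesis
      proof (cases "y \<in> F")
        case True
        then have "y \<in> K" using y by (simp add: K_def nb_def)
        moreover have "?\<rho> (tail y) = (\<lambda>j. 0)" using True by (auto simp: tail_def proj_def)
        ultimately show ?thesis unfolding hy by (simp add: spike_glue_zero RK(3))
      next
        case False
        let ?s = "fp y"
        have yX: "y \<in> X" using y by (simp add: nb_def)
        have "?\<rho> (tail y) = spike (list_encode ?s) (?\<rho> (\<Phi> ?s y))"
          using False by (auto simp: tail_def proj_def spike_def)
        then have "h (?\<rho> (\<phi> y)) = G ?s (pre (RK y) (list_encode ?s)) (?\<rho> (\<Phi> ?s y))"
          unfolding hy by (simp add: spike_glue_spike)
        moreover have "y \<in> A \<longleftrightarrow> H ?s (?\<rho> (?\<rho> (\<Phi> ?s y))) \<in> A"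
          unfolding \<rho>\<rho> by (rule H\<Phi>[OF fp[OF yX False]])
        moreover have "RK y \<in> F" using RK(2) KF by blast
        ultimately show ?thesis using G(2) by metis
      qed
    qed
    then have "sm (pre z n0)" unfolding sm_def small_def using h \<phi> by blast
    then show False using z by (simp add: F_def)
  qed
  then obtain h where h: "cont h" and
    nsd: "\<not> (\<exists>k. cont k \<and> (\<forall>y. h (?\<rho> y) \<in> A \<longleftrightarrow> k (?\<rho> y) \<notin> A))" by blast
  have B: "{y. h (?\<rho> y) \<in> A} \<in> \<S>" by (rule vimage_S[OF cont_comp[OF h cont_proj] A(1)])
  have "\<not> (\<exists>g. cont g \<and> (\<forall>x. x \<in> {y. h (?\<rho> y) \<in> A} \<longleftrightarrow> g x \<notin> A))"
  proof
    assume "\<exists>g. cont g \<and> (\<forall>x. x \<in> {y. h (?\<rho> y) \<in> A} \<longleftrightarrow> g x \<notin> A)"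
    then obtain g where g: "cont g" "\<And>x. h (?\<rho> x) \<in> A \<longleftrightarrow> g x \<notin> A" by auto
    have "h (?\<rho> x) \<in> A \<longleftrightarrow> g (?\<rho> x) \<notin> A" for x
    proof -
      have "h (?\<rho> (?\<rho> x)) \<in> A \<longleftrightarrow> g (?\<rho> x) \<notin> A" by (rule g(2))
      then show ?thesis unfolding \<rho>\<rho> .
    qed
    then show False using nsd g(1) by blast
  qed
  then obtain \<sigma> where "\<And>y. y \<in> A \<longleftrightarrow> strategy_map \<sigma> y \<in> {y. h (?\<rho> y) \<in> A}"
    using wadge[OF B A(1)] by blast
  then show ?thesis using cont_strategy_map h by (intro exI[of _ "strategy_map \<sigma>"] exI[of _ h]) simp
qed

section \<open>Zero-dimensional Polish spaces as retracts of Baire space\<close>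

text \<open>Separability gives countably many small clopen sets that cover the space, and subtracting from each one its
  predecessors makes them disjoint.\<close>

lemma clopen_partition:
  assumes M: "Metric_space M d" and Z: "Z = Metric_space.mtopology M d"
    and sep: "separable_space Z" and zd: "zero_dimensional Z" and e: "e > 0"
  shows "\<exists>P :: nat \<Rightarrow> 'a set. (\<forall>m. openin Z (P m)) \<and> (\<forall>m. closedin Z (P m)) \<and>
    \<Union> (range P) = topspace Z \<and> disjoint_family P \<and> (\<forall>m. \<exists>a. P m \<subseteq> Metric_space.mcball M d a e)"
proof -
  interpret Metric_space M d by (rule M)
  have top: "topspace Z = M" using Z by simp
  obtain \<B> where \<B>: "\<And>B. B \<in> \<B> \<Longrightarrow> openin Z B \<and> closedin Z B"
    and base: "openin Z = arbitrary union_of (\<lambda>B. B \<in> \<B>)"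
    using zd unfolding zero_dimensional_def by blast
  obtain C where C: "countable C" "C \<subseteq> M" "Z closure_of C = M"
    using sep unfolding separable_space_def top by blast
  define ok where "ok = (\<lambda>k U. (case prod_decode k of (i, n) \<Rightarrow>
     mball (from_nat_into C i) (1 / real (Suc n)) \<subseteq> U) \<and> openin Z U \<and> closedin Z U \<and> (\<exists>a. U \<subseteq> mcball a e))"
  define U where "U = (\<lambda>k. if \<exists>V. ok k V then SOME V. ok k V else {})"
  have U: "openin Z (U k) \<and> closedin Z (U k) \<and> (\<exists>a. U k \<subseteq> mcball a e)" for k
  proof (cases "\<exists>V. ok k V")
    case True
    then have "ok k (U k)" unfolding U_def by (simp add: someI_ex)
    then show ?thesis by (simp add: ok_def)
  next
    case False
    then have "U k = {}" unfolding U_def by (rule if_not_P)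
    then show ?thesis by simp
  qed
  have cover: "\<Union> (range U) = topspace Z"
  proof
    show "\<Union> (range U) \<subseteq> topspace Z" using U openin_subset by blast
    show "topspace Z \<subseteq> \<Union> (range U)"
    proof
      fix z assume "z \<in> topspace Z"
      then have z: "z \<in> M" by (simp add: top)
      have "openin Z (mball z e)" by (simp add: Z)
      then have "(arbitrary union_of (\<lambda>B. B \<in> \<B>)) (mball z e)" using base by simp
      then obtain B where B: "B \<in> \<B>" "z \<in> B" "B \<subseteq> mball z e"
        unfolding arbitrary_union_of_alt using z e by (metis centre_in_mball_iff)
      obtain r where r: "r > 0" "mball z r \<subseteq> B"
        using \<B>[OF B(1)] B(2) unfolding Z openin_mtopology by blast
      obtain n where n: "1 / real (Suc n) < r / 2"
        using r(1) by (meson half_gt_zero nat_approx_posE)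
      have "z \<in> Z closure_of C" using C(3) z by simp
      then have "\<exists>c\<in>C. c \<in> mball z (1 / real (Suc n))"
        unfolding Z metric_closure_of by simp
      then obtain c where c: "c \<in> C" "d z c < 1 / real (Suc n)" by auto
      then obtain i where i: "from_nat_into C i = c" using from_nat_into_surj[OF C(1)] by blast
      have cM: "c \<in> M" using c C(2) by blast
      have sub: "mball c (1 / real (Suc n)) \<subseteq> mball z r"
      proof
        fix w assume w: "w \<in> mball c (1 / real (Suc n))"
        then have "d z w \<le> d z c + d c w" using z cM triangle by auto
        then show "w \<in> mball z r" using w c(2) n z by auto
      qed
      have "B \<subseteq> mcball z e" using B(3) mball_subset_mcball by (rule order_trans)
      then have "ok (prod_encode (i, n)) B"
        unfolding ok_def using sub r(2) \<B>[OF B(1)] i by auto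
      then have "ok (prod_encode (i, n)) (U (prod_encode (i, n)))"
        unfolding U_def by (metis (mono_tags, lifting) someI_ex)
      then have "mball c (1 / real (Suc n)) \<subseteq> U (prod_encode (i, n))" by (simp add: ok_def i)
      moreover have "z \<in> mball c (1 / real (Suc n))" using c z cM by (simp add: commute)
      ultimately show "z \<in> \<Union> (range U)" by blast
    qed
  qed
  have dis: "disjointed U m = U m - (\<Union>i\<in>{0..<m}. U i)" for m by (simp add: disjointed_def)
  have "openin Z (disjointed U m)" for m
    unfolding dis using U by (intro openin_diff closedin_Union) auto
  moreover have "closedin Z (disjointed U m)" for m
    unfolding dis using U by (intro closedin_diff openin_Union) auto
  moreover have "\<Union> (range (disjointed U)) = topspace Z" using cover UN_disjointed_eq[of U] by simp
  moreover have "\<exists>a. disjointed U m \<subseteq> mcball a e" for m using U[of m] disjointed_subset[of U m] by blast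
  ultimately show ?thesis using disjoint_family_disjointed[of U] by blast
qed

text \<open>The point \<open>z\<close> is sent to the sequence of the indices of its pieces in finer and finer clopen
  partitions. By completeness the range of this embedding is closed, hence a retract of Baire space.\<close>

theorem retract_of_Baire_space:
  assumes "polish Z" "zero_dimensional Z"
  shows "\<exists>i r. continuous_map Z omega_omega i \<and> continuous_map omega_omega Z r \<and>
    (\<forall>z\<in>topspace Z. r (i z) = z)"
proof -
  obtain M d where M: "Metric_space M d" and mc: "Metric_space.mcomplete M d"
    and Z: "Z = Metric_space.mtopology M d" and sep: "separable_space Z"
    using assms(1) unfolding polish_def completely_metrizable_space_def by blast
  interpret Metric_space M d by (rule M)
  have top: "topspace Z = M" using Z by simp
  define ep where "ep = (\<lambda>n. 1 / real (Suc n))"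
  have ep: "ep n > 0" for n by (simp add: ep_def)
  have "\<forall>n. \<exists>P :: nat \<Rightarrow> 'a set. (\<forall>m. openin Z (P m)) \<and> (\<forall>m. closedin Z (P m)) \<and>
    \<Union> (range P) = topspace Z \<and> disjoint_family P \<and> (\<forall>m. \<exists>a. P m \<subseteq> mcball a (ep n))"
    using clopen_partition[OF M Z sep assms(2) ep] by blast
  then obtain P :: "nat \<Rightarrow> nat \<Rightarrow> 'a set" where Po: "\<And>n m. openin Z (P n m)"
    and Pc: "\<And>n m. closedin Z (P n m)" and cover: "\<And>n. \<Union> (range (P n)) = M"
    and dj: "\<And>n. disjoint_family (P n)" and small: "\<And>n m. \<exists>a. P n m \<subseteq> mcball a (ep n)"
    unfolding top by metis
  define i where "i = (\<lambda>z n. SOME m. z \<in> P n m)"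
  have iP: "z \<in> P n m \<longleftrightarrow> i z n = m" if z: "z \<in> M" for z n m
  proof -
    have "\<exists>m. z \<in> P n m" using cover[of n] z by blast
    then have "z \<in> P n (i z n)" unfolding i_def by (rule someI_ex)
    then show ?thesis using dj[of n] unfolding disjoint_family_on_def by blast
  qed
  have diam: "d z w \<le> 2 * ep n" if "z \<in> M" "w \<in> M" "i z n = i w n" for z w n
  proof -
    obtain a where a: "P n (i z n) \<subseteq> mcball a (ep n)" using small by blast
    have "z \<in> P n (i z n)" "w \<in> P n (i z n)" using iP that by auto
    then have "z \<in> mcball a (ep n)" "w \<in> mcball a (ep n)" using a by auto
    then have "a \<in> M" "d a z \<le> ep n" "d a w \<le> ep n" by auto
    moreover have "d z w \<le> d a z + d a w" using triangle[of z a w] that calculation commute[of z a] by simp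
    ultimately show ?thesis by simp
  qed
  have ex_ep: "\<exists>n. 2 * ep n < e" if "e > 0" for e
  proof -
    have "0 < e / 2" using that by simp
    then obtain n where "1 / real (Suc n) < e / 2" by (meson nat_approx_posE)
    then show ?thesis by (intro exI[of _ n]) (simp add: ep_def)
  qed
  have i_inj: "z = w" if "z \<in> M" "w \<in> M" "i z = i w" for z w
  proof (rule ccontr)
    assume "z \<noteq> w"
    then have "d z w > 0" using that by simp
    then obtain n where "2 * ep n < d z w" using ex_ep by blast
    then show False using diam[of z w n] that by simp
  qed
  have i: "continuous_map Z omega_omega i"
    unfolding continuous_map_omega_omega
  proof (intro allI)
    fix n a
    have "{z \<in> topspace Z. i z n = a} = P n a"
      using iP openin_subset[OF Po, of n a] by (auto simp: top)
    then show "openin Z {z \<in> topspace Z. i z n = a}" using Po by simp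
  qed
  \<comment> \<open>Cantor's intersection theorem produces a preimage of each limit of the range.\<close>
  have "closedin omega_omega (i ` M)"
    unfolding closedin_omega_omega
  proof (intro allI impI)
    fix x assume *: "\<forall>n. \<exists>y\<in>i ` M. pre y n = pre x n"
    define C where "C = (\<lambda>n. \<Inter>k\<in>{..n}. P k (x k))"
    have "closedin mtopology (C n)" for n unfolding C_def using Pc Z by (intro closedin_Inter) auto
    moreover have "C n \<noteq> {}" for n
    proof -
      obtain z where z: "z \<in> M" "pre (i z) (Suc n) = pre x (Suc n)" using * by blast
      then have "z \<in> C n" unfolding C_def using iP by (auto simp: pre_eq_iff)
      then show ?thesis by blast
    qed
    moreover have "decseq C" unfolding C_def decseq_def by auto
    moreover have "\<exists>n a. C n \<subseteq> mcball a e" if e: "e > 0" for e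
    proof -
      obtain n where n: "2 * ep n < e" using ex_ep[OF e] by blast
      obtain a where a: "P n (x n) \<subseteq> mcball a (ep n)" using small by blast
      have "C n \<subseteq> P n (x n)" by (auto simp: C_def)
      moreover have "mcball a (ep n) \<subseteq> mcball a e" by (rule mcball_subset_concentric) (use n ep[of n] in linarith)
      ultimately show ?thesis using a by blast
    qed
    ultimately obtain l where l: "l \<in> M" "\<Inter> (range C) = {l}"
      using mc unfolding mcomplete_nest_sing by metis
    have "i l n = x n" for n
    proof -
      have "l \<in> C n" using l(2) by blast
      then show ?thesis using iP[OF l(1)] by (auto simp: C_def)
    qed
    then have "i l = x" by (rule ext)
    then show "x \<in> i ` M" using l(1) by blast
  qed
  moreover have "i ` M \<noteq> {}" using assms(2) top by (auto simp: zero_dimensional_def)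
  ultimately obtain R where R: "cont R" "\<And>x. R x \<in> i ` M" "\<And>x. x \<in> i ` M \<Longrightarrow> R x = x"
    using retraction_onto_closed by blast
  define r where "r = (\<lambda>x. inv_into M i (R x))"
  have r: "r x \<in> M" "i (r x) = R x" for x
    unfolding r_def using R(2) by (auto intro: inv_into_into f_inv_into_f)
  have "continuous_map omega_omega Z r"
    unfolding continuous_map_def
  proof (intro conjI allI impI)
    show "r \<in> topspace omega_omega \<rightarrow> topspace Z" using r by (simp add: top)
    fix U assume U: "openin Z U"
    show "openin omega_omega {x \<in> topspace omega_omega. r x \<in> U}"
      unfolding openin_omega_omega
    proof
      fix x assume "x \<in> {x \<in> topspace omega_omega. r x \<in> U}"
      then obtain e where e: "e > 0" "mball (r x) e \<subseteq> U"
        using U unfolding Z openin_mtopology by blast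
      obtain n where n: "2 * ep n < e" using ex_ep e(1) by blast
      obtain k where k: "\<And>y. pre y k = pre x k \<Longrightarrow> pre (R y) (Suc n) = pre (R x) (Suc n)"
        using cont_pre[OF R(1)] by blast
      have "r y \<in> U" if "pre y k = pre x k" for y
      proof -
        have "i (r x) n = i (r y) n" using k[OF that] by (simp add: r(2) pre_eq_iff)
        then have "d (r x) (r y) \<le> 2 * ep n" by (rule diam[OF r(1) r(1)])
        then have "r y \<in> mball (r x) e" using n r(1) by simp
        then show ?thesis using e(2) by blast
      qed
      then show "\<exists>n. \<forall>y. pre y n = pre x n \<longrightarrow> y \<in> {x \<in> topspace omega_omega. r x \<in> U}" by auto
    qed
  qed
  moreover have "r (i z) = z" if "z \<in> topspace Z" for z
  proof (rule i_inj)
    show "i (r (i z)) = i z" using that R(3) by (simp add: r(2) top)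
  qed (use that r top in auto)
  ultimately show ?thesis using i by blast
qed

section \<open>Cubes as retracts\<close>

text \<open>The embedding \<open>e\<close> follows a tree of nodes of \<open>F\<close> at each of which the set branches
  into distinct directions labelled by \<open>S\<close>. The retraction \<open>q\<close> descends this tree
  and reads off the labels; when its argument leaves the tree, it continues with the label \<open>0\<close>.\<close>

theorem cube_retract_of_branching_set:
  assumes F: "closedin omega_omega F" "F \<noteq> {}" and S: "0 \<in> S"
    and split: "\<And>z n. z \<in> F \<Longrightarrow> \<exists>X i. n \<le> i \<and>
      (\<forall>a\<in>S. X a \<in> F \<and> pre (X a) i = pre (X 0) i \<and> pre (X a) n = pre z n) \<and> inj_on (\<lambda>a. X a i) S"
  shows "\<exists>e q. cont e \<and> cont q \<and> (\<forall>x. e x \<in> F) \<and> (\<forall>w. q w \<in> cube S) \<and> (\<forall>x\<in>cube S. q (e x) = x)"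
proof -
  have "\<forall>z n. \<exists>X i. z \<in> F \<longrightarrow> n \<le> i \<and>
      (\<forall>a\<in>S. X a \<in> F \<and> pre (X a) i = pre (X 0) i \<and> pre (X a) n = pre z n) \<and> inj_on (\<lambda>a. X a i) S"
    using split by blast
  then obtain br lev where br: "\<And>z n. z \<in> F \<Longrightarrow> n \<le> lev z n \<and>
      (\<forall>a\<in>S. br z n a \<in> F \<and> pre (br z n a) (lev z n) = pre (br z n 0) (lev z n) \<and> pre (br z n a) n = pre z n) \<and>
      inj_on (\<lambda>a. br z n a (lev z n)) S"
    unfolding choice_iff by blast
  obtain z0 where z0: "z0 \<in> F" using F(2) by blast
  \<comment> \<open>A state \<open>(z, n)\<close> stands for the node \<open>pre z n\<close>; the branching occurs further up,
    at level \<open>lev z n\<close>.\<close>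
  define step where "step = (\<lambda>p a. (br (fst p) (snd p) a, Suc (lev (fst p) (snd p))))"
  define st where "st = foldl step (z0, 0)"
  have st_Nil: "st [] = (z0, 0)" by (simp add: st_def)
  have st_snoc: "st (s @ [a]) = step (st s) a" for s a by (simp add: st_def)
  have stF: "fst (st (pre x n)) \<in> F" if "x \<in> cube S" for x n
  proof (induction n)
    case (Suc n)
    then show ?case using br that by (simp add: pre_Suc st_snoc step_def cube_def)
  qed (simp add: st_Nil z0)
  have lev_step: "snd (st (pre x (Suc n))) = Suc (lev (fst (st (pre x n))) (snd (st (pre x n))))" for x n
    by (simp add: pre_Suc st_snoc step_def)
  have lev_less: "snd (st (pre x n)) < snd (st (pre x (Suc n)))" if "x \<in> cube S" for x n
    using br[OF stF[OF that], of "snd (st (pre x n))" n] unfolding lev_step by (simp add: less_Suc_eq_le)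
  have lev_ge: "n \<le> snd (st (pre x n))" if "x \<in> cube S" for x n
  proof (induction n)
    case (Suc n)
    then show ?case using lev_less[OF that, of n] by simp
  qed simp
  have lev_mono: "snd (st (pre x n)) \<le> snd (st (pre x m))" if "x \<in> cube S" "n \<le> m" for x n m
    using that(2)
  proof (induction m rule: dec_induct)
    case (step m)
    then show ?case using lev_less[OF that(1), of m] by simp
  qed simp
  have stable: "pre (fst (st (pre x m))) (snd (st (pre x n))) = pre (fst (st (pre x n))) (snd (st (pre x n)))"
    if x: "x \<in> cube S" and "n \<le> m" for x n m
    using that(2)
  proof (induction m rule: dec_induct)
    case (step m)
    have "x m \<in> S" using x by (simp add: cube_def)
    then have "pre (fst (st (pre x (Suc m)))) (snd (st (pre x m))) = pre (fst (st (pre x m))) (snd (st (pre x m)))"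
      using br[OF stF[OF x]] by (simp add: pre_Suc st_snoc step_def)
    from pre_eq_mono[OF this lev_mono[OF x step(1)]] show ?case using step.IH by simp
  qed simp
  define e0 where "e0 = strategy_map (\<lambda>s. fst (st s) (length s - 1))"
  define e where "e = (\<lambda>x. e0 (proj S x))"
  have e0: "pre (e0 x) (snd (st (pre x n))) = pre (fst (st (pre x n))) (snd (st (pre x n)))"
    if x: "x \<in> cube S" for x n
    unfolding pre_eq_iff
  proof (intro allI impI)
    fix j assume j: "j < snd (st (pre x n))"
    have e0j: "e0 x j = fst (st (pre x (Suc j))) j" by (simp add: e0_def strategy_map_def)
    show "e0 x j = fst (st (pre x n)) j"
    proof (cases "n \<le> Suc j")
      case True
      from stable[OF x this] show ?thesis using j unfolding e0j pre_eq_iff by blast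
    next
      case False
      then have "Suc j \<le> n" by simp
      from stable[OF x this] show ?thesis using lev_ge[OF x, of "Suc j"] unfolding e0j pre_eq_iff by simp
    qed
  qed
  have "cont e" unfolding e_def e0_def by (rule cont_comp[OF cont_strategy_map cont_proj])
  moreover have e0F: "e0 x \<in> F" if x: "x \<in> cube S" for x
  proof -
    have "\<exists>y\<in>F. pre y n = pre (e0 x) n" for n
      using pre_eq_mono[OF e0[OF x] lev_ge[OF x], of n] stF[OF x] by (metis)
    then show ?thesis using F(1) unfolding closedin_omega_omega by blast
  qed
  then have "e x \<in> F" for x unfolding e_def using proj_in_cube[OF S] by blast
  moreover
  define pick where "pick = (\<lambda>p w. let i = lev (fst p) (snd p) in
     if \<exists>a\<in>S. br (fst p) (snd p) a i = w i then SOME a. a \<in> S \<and> br (fst p) (snd p) a i = w i else (0::nat))"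
  have pickS: "pick p w \<in> S" for p w
  proof (cases "\<exists>a\<in>S. br (fst p) (snd p) a (lev (fst p) (snd p)) = w (lev (fst p) (snd p))")
    case True
    then have "(SOME a. a \<in> S \<and> br (fst p) (snd p) a (lev (fst p) (snd p)) = w (lev (fst p) (snd p))) \<in> S"
      by (metis (mono_tags, lifting) someI_ex)
    then show ?thesis using True by (simp add: pick_def Let_def)
  qed (simp add: pick_def Let_def S)
  \<comment> \<open>The labels that \<open>w\<close> passes through, as a list.\<close>
  define dec where "dec = (\<lambda>w. rec_nat [] (\<lambda>_ s. s @ [pick (st s) w]))"
  have dec: "dec w 0 = []" "dec w (Suc n) = dec w n @ [pick (st (dec w n)) w]" for w n
    by (simp_all add: dec_def)
  define q where "q = (\<lambda>w n. pick (st (dec w n)) w)"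
  have dec_cont: "\<exists>m. \<forall>y. pre y m = pre x m \<longrightarrow> dec y n = dec x n" for x n
  proof (induction n)
    case (Suc n)
    then obtain m where m: "\<And>y. pre y m = pre x m \<Longrightarrow> dec y n = dec x n" by blast
    let ?i = "lev (fst (st (dec x n))) (snd (st (dec x n)))"
    have "dec y (Suc n) = dec x (Suc n)" if y: "pre y (max m (Suc ?i)) = pre x (max m (Suc ?i))" for y
    proof -
      have d: "dec y n = dec x n" by (rule m, rule pre_eq_mono[OF y]) simp
      have "y ?i = x ?i" using y by (simp add: pre_eq_iff)
      then show ?thesis unfolding dec d pick_def Let_def by simp
    qed
    then show ?case by blast
  qed (simp add: dec)
  have "cont q"
  proof (rule contI)
    fix x n
    have "q y n = last (dec y (Suc n))" for y by (simp add: q_def dec)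
    then show "\<exists>m. \<forall>y. pre y m = pre x m \<longrightarrow> q y n = q x n" using dec_cont[of x "Suc n"] by metis
  qed
  moreover have "q w \<in> cube S" for w by (simp add: cube_def q_def pickS)
  moreover have "q (e x) = x" if x: "x \<in> cube S" for x
  proof -
    have ex: "e x = e0 x" unfolding e_def by (simp add: proj_cube[OF x])
    have pk: "pick (st (pre x n)) (e0 x) = x n" for n
    proof -
      let ?z = "fst (st (pre x n))" and ?k = "snd (st (pre x n))"
      let ?i = "lev ?z ?k"
      have xS: "x n \<in> S" using x by (simp add: cube_def)
      have "fst (st (pre x (Suc n))) = br ?z ?k (x n)" by (simp add: pre_Suc st_snoc step_def)
      then have w: "br ?z ?k (x n) ?i = e0 x ?i"
        using e0[OF x, of "Suc n"] unfolding lev_step by (simp add: pre_eq_iff)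
      have "(SOME a. a \<in> S \<and> br ?z ?k a ?i = e0 x ?i) = x n"
      proof (rule some_equality)
        show "x n \<in> S \<and> br ?z ?k (x n) ?i = e0 x ?i" using xS w by simp
        fix a assume "a \<in> S \<and> br ?z ?k a ?i = e0 x ?i"
        then show "a = x n" using br[OF stF[OF x]] xS w by (metis (no_types, lifting) inj_on_def)
      qed
      then show ?thesis using xS w by (auto simp: pick_def Let_def)
    qed
    have "dec (e0 x) n = pre x n" for n
      by (induction n) (simp_all add: dec pk pre_Suc)
    then show ?thesis unfolding ex q_def using pk by auto
  qed
  ultimately show ?thesis by blast
qed

text \<open>The condensation points of an uncountable closed set form a non-empty perfect set, where every node branches
  into two.\<close>

lemma cantor_retract_of_uncountable:
  assumes X: "closedin omega_omega X" "uncountable X"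
  shows "\<exists>e q. cont e \<and> cont q \<and> (\<forall>x. e x \<in> X) \<and> (\<forall>w. q w \<in> cube {0, 1}) \<and> (\<forall>x\<in>cube {0, 1}. q (e x) = x)"
proof -
  define nb where "nb = (\<lambda>s. {y \<in> X. pre y (length s) = s})"
  define F where "F = {z \<in> X. \<forall>n. uncountable (nb (pre z n))}"
  \<comment> \<open>Only countably many points have a countable basic neighbourhood, as there are countably many prefixes.\<close>
  have "X - F \<subseteq> (\<Union>s\<in>{s. countable (nb s)}. nb s)"
  proof
    fix x assume "x \<in> X - F"
    then obtain n where "x \<in> X" "countable (nb (pre x n))" by (auto simp: F_def)
    then show "x \<in> (\<Union>s\<in>{s. countable (nb s)}. nb s)" by (intro UN_I[of "pre x n"]) (auto simp: nb_def)
  qed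
  moreover have "countable (\<Union>s\<in>{s. countable (nb s)}. nb s)" by (rule countable_UN) auto
  ultimately have XF: "countable (X - F)" by (rule countable_subset)
  have "F \<noteq> {}" using XF X(2) by auto
  moreover have "closedin omega_omega F"
    unfolding closedin_omega_omega
  proof (intro allI impI)
    fix x assume *: "\<forall>n. \<exists>y\<in>F. pre y n = pre x n"
    then have "x \<in> X" using X(1) unfolding closedin_omega_omega F_def by blast
    moreover have "uncountable (nb (pre x n))" for n
    proof -
      obtain y where "y \<in> F" "pre y n = pre x n" using * by blast
      then show ?thesis unfolding F_def by (metis (mono_tags, lifting) mem_Collect_eq)
    qed
    ultimately show "x \<in> F" by (simp add: F_def)
  qed
  moreover have "\<exists>x i. n \<le> i \<and>
      (\<forall>a\<in>{0, 1}. x a \<in> F \<and> pre (x a) i = pre (x 0) i \<and> pre (x a) n = pre z n) \<and> inj_on (\<lambda>a. x a i) {0, 1::nat}"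
    if z: "z \<in> F" for z n
  proof -
    have "nb (pre z n) \<subseteq> (nb (pre z n) \<inter> F) \<union> (X - F)" by (auto simp: nb_def)
    moreover have "uncountable (nb (pre z n))" using z by (simp add: F_def)
    ultimately have "uncountable (nb (pre z n) \<inter> F)" using XF countable_Un countable_subset by metis
    then have "\<exists>x y. x \<in> nb (pre z n) \<inter> F \<and> y \<in> nb (pre z n) \<inter> F \<and> x \<noteq> y"
      by (metis countable_finite finite.emptyI finite.insertI finite_subset insertCI subsetI)
    then obtain x y where xy: "x \<in> F" "y \<in> F" "pre x n = pre z n" "pre y n = pre z n" "x \<noteq> y"
      by (auto simp: nb_def)
    define i where "i = (LEAST i. x i \<noteq> y i)"
    have "\<exists>i. x i \<noteq> y i" using xy(5) by (auto simp: fun_eq_iff)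
    then have i: "x i \<noteq> y i" unfolding i_def by (rule LeastI_ex)
    have i': "x j = y j" if "j < i" for j using that not_less_Least unfolding i_def by blast
    have "n \<le> i"
    proof (rule ccontr)
      assume "\<not> n \<le> i"
      then show False using i xy(3,4) by (simp add: pre_eq_iff)
    qed
    moreover have "pre y i = pre x i" using i' by (simp add: pre_eq_iff)
    ultimately show ?thesis using xy i
      by (intro exI[of _ "\<lambda>a. if a = 0 then x else y"] exI[of _ i]) (auto simp: inj_on_def)
  qed
  ultimately have "\<exists>e q. cont e \<and> cont q \<and> (\<forall>x. e x \<in> F) \<and> (\<forall>w. q w \<in> cube {0, 1}) \<and>
      (\<forall>x\<in>cube {0, 1}. q (e x) = x)"
    by (intro cube_retract_of_branching_set) simp_all
  moreover have "F \<subseteq> X" by (auto simp: F_def)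
  ultimately show ?thesis by blast
qed

text \<open>A bounded closed set of sequences is compact, so this is about sets that are nowhere locally compact. By
  K\<ouml>nig's lemma every node then has an extension with infinitely many successors.\<close>

lemma Baire_retract_of_unbounded:
  assumes F: "closedin omega_omega F" "F \<noteq> {}" and unb: "\<And>z n. z \<in> F \<Longrightarrow> \<not> bounded_piece F (pre z n)"
  shows "\<exists>e q. cont e \<and> cont q \<and> (\<forall>x. e x \<in> F) \<and> (\<forall>w. q w \<in> cube UNIV) \<and> (\<forall>x\<in>cube UNIV. q (e x) = x)"
proof (rule cube_retract_of_branching_set[OF F])
  fix z n assume z: "z \<in> F"
  define Y where "Y = {x \<in> F. pre x n = pre z n}"
  have "\<exists>i. infinite ((\<lambda>x. x i) ` Y)"
  proof (rule ccontr)
    assume "\<nexists>i. infinite ((\<lambda>x. x i) ` Y)"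
    then have "\<forall>x\<in>F. pre x n = pre z n \<longrightarrow> (\<forall>i. x i \<le> Max ((\<lambda>x. x i) ` Y))"
      by (auto simp: Y_def intro!: Max_ge)
    then have "bounded_piece F (pre z n)" unfolding bounded_piece_def by (intro exI) simp
    then show False using unb[OF z] by blast
  qed
  \<comment> \<open>At the first level with infinitely many values there are only finitely many nodes, so one of them has
    infinitely many successors.\<close>
  define i where "i = (LEAST i. infinite ((\<lambda>x. x i) ` Y))"
  have i: "infinite ((\<lambda>x. x i) ` Y)" unfolding i_def using \<open>\<exists>i. _\<close> by (rule LeastI_ex)
  have i': "finite ((\<lambda>x. x j) ` Y)" if "j < i" for j using that not_less_Least unfolding i_def by blast
  have "n \<le> i"
  proof (rule ccontr)
    assume "\<not> n \<le> i"
    then have "(\<lambda>x. x i) ` Y \<subseteq> {z i}" by (auto simp: Y_def pre_eq_iff)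
    then show False using i finite_subset by blast
  qed
  let ?V = "\<Union>j<i. (\<lambda>x. x j) ` Y"
  have "finite ?V" using i' by blast
  then have "finite {s. set s \<subseteq> ?V \<and> length s = i}" by (rule finite_lists_length_eq)
  moreover have "(\<lambda>x. pre x i) ` Y \<subseteq> {s. set s \<subseteq> ?V \<and> length s = i}" unfolding pre_def by fastforce
  ultimately have fin: "finite ((\<lambda>x. pre x i) ` Y)" using finite_subset by blast
  have "(\<lambda>x. x i) ` Y \<subseteq> (\<Union>t\<in>(\<lambda>x. pre x i) ` Y. (\<lambda>x. x i) ` {x \<in> Y. pre x i = t})" by auto
  then have "\<exists>t. infinite ((\<lambda>x. x i) ` {x \<in> Y. pre x i = t})"
    using i fin by (meson finite_UN_I finite_subset)
  then obtain t where "infinite ((\<lambda>x. x i) ` {x \<in> Y. pre x i = t})" by blast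
  then obtain c :: "nat \<Rightarrow> nat" where c: "inj c" "range c \<subseteq> (\<lambda>x. x i) ` {x \<in> Y. pre x i = t}"
    using infinite_countable_subset by blast
  have "\<exists>x. x \<in> Y \<and> pre x i = t \<and> x i = c a" for a
  proof -
    have "c a \<in> (\<lambda>x. x i) ` {x \<in> Y. pre x i = t}" using c(2) by blast
    then show ?thesis by force
  qed
  then obtain X where "\<And>a. X a \<in> Y" "\<And>a. pre (X a) i = t" "\<And>a. X a i = c a" by metis
  then show "\<exists>X i. n \<le> i \<and>
      (\<forall>a\<in>(UNIV :: nat set). X a \<in> F \<and> pre (X a) i = pre (X 0) i \<and> pre (X a) n = pre z n) \<and> inj_on (\<lambda>a. X a i) UNIV"
    using \<open>n \<le> i\<close> c(1) by (intro exI[of _ X] exI[of _ i]) (auto simp: Y_def)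
qed simp

section \<open>The additive Borel classes of Baire space\<close>

lemma Sigma0_vimage:
  assumes f: "continuous_map Z W f" and A: "A \<in> Sigma0 \<xi> W"
  shows "preimage Z f A \<in> Sigma0 \<xi> Z"
proof -
  have "(\<xi>, A) \<in> additive_borel W" using A by (simp add: Sigma0_def)
  then have "(\<xi>, preimage Z f A) \<in> additive_borel Z"
  proof (induction \<xi> A rule: additive_borel.induct)
    case (open_sets U)
    then show ?case using f openin_continuous_map_preimage additive_borel.open_sets by blast
  next
    case (union \<eta> \<xi> A)
    have "f z \<in> topspace W" if "z \<in> topspace Z" for z
      using f that by (auto simp: continuous_map_def)
    then have "preimage Z f (\<Union>n. topspace W - A n) = (\<Union>n. topspace Z - preimage Z f (A n))"
      by auto
    then show ?case using additive_borel.union[of \<eta> \<xi> "\<lambda>n. preimage Z f (A n)" Z] union by simp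
  qed
  then show ?thesis by (simp add: Sigma0_def)
qed

abbreviation Sigma0_omega :: "omega1 \<Rightarrow> (nat \<Rightarrow> nat) set set" where
  "Sigma0_omega \<xi> \<equiv> Sigma0 \<xi> omega_omega"

lemma Sigma0_omega_vimage: "cont f \<Longrightarrow> A \<in> Sigma0_omega \<xi> \<Longrightarrow> {x. f x \<in> A} \<in> Sigma0_omega \<xi>"
  using Sigma0_vimage[of omega_omega omega_omega f A \<xi>] by simp

lemma Sigma0_omega_I:
  assumes "\<And>n :: nat. \<exists>\<eta>. 1 \<le> \<eta> \<and> \<eta> < \<xi> \<and> A n \<in> Sigma0_omega \<eta>"
  shows "(\<Union>n. - A n) \<in> Sigma0_omega \<xi>"
proof -
  have "1 < \<xi>" using assms[of 0] by (meson order.strict_trans1)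
  then show ?thesis using assms by (auto simp: Sigma0_gt_one Compl_eq_Diff_UNIV)
qed

lemma Sigma0_omega_E:
  assumes "1 < \<xi>" "B \<in> Sigma0_omega \<xi>"
  obtains A \<eta> where "B = (\<Union>n :: nat. - A n)" "\<And>n. 1 \<le> \<eta> n \<and> \<eta> n < \<xi> \<and> A n \<in> Sigma0_omega (\<eta> n)"
proof -
  obtain A where A: "B = (\<Union>n :: nat. - A n)" "\<forall>n. \<exists>\<eta>. 1 \<le> \<eta> \<and> \<eta> < \<xi> \<and> A n \<in> Sigma0_omega \<eta>"
    using assms by (auto simp: Sigma0_gt_one Compl_eq_Diff_UNIV)
  then obtain \<eta> where "\<And>n. 1 \<le> \<eta> n \<and> \<eta> n < \<xi> \<and> A n \<in> Sigma0_omega (\<eta> n)" by metis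
  then show ?thesis using that A(1) by blast
qed

lemma Sigma0_omega_one_iff: "U \<in> Sigma0_omega 1 \<longleftrightarrow> openin omega_omega U"
  by (simp add: Sigma0_one)

lemma Sigma0_omega_Compl: "1 \<le> \<eta> \<Longrightarrow> \<eta> < \<xi> \<Longrightarrow> A \<in> Sigma0_omega \<eta> \<Longrightarrow> - A \<in> Sigma0_omega \<xi>"
  using Sigma0_omega_I[of \<xi> "\<lambda>_. A"] by auto

lemma Sigma0_omega_mono:
  assumes "1 \<le> \<eta>" "\<eta> \<le> \<xi>" "A \<in> Sigma0_omega \<eta>"
  shows "A \<in> Sigma0_omega \<xi>"
proof (cases "\<eta> = \<xi> \<or> \<eta> \<noteq> 1")
  case True
  then show ?thesis
  proof
    assume "\<eta> \<noteq> 1"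
    then have "1 < \<eta>" using assms(1) by simp
    then obtain B \<theta> where "A = (\<Union>n :: nat. - B n)" "\<And>n. 1 \<le> \<theta> n \<and> \<theta> n < \<eta> \<and> B n \<in> Sigma0_omega (\<theta> n)"
      using Sigma0_omega_E[OF _ assms(3)] by metis
    then show ?thesis using Sigma0_omega_I[of \<xi> B] assms(2) by (meson order.strict_trans2)
  qed (use assms in simp)
next
  case False
  then have \<xi>: "1 < \<xi>" and A: "openin omega_omega A" using assms Sigma0_omega_one_iff by auto
  \<comment> \<open>An open set is the union of the clopen sets \<open>D n\<close> of the points whose membership is decided
    by \<open>n\<close> entries.\<close>
  define D where "D = (\<lambda>n. {x. \<forall>y. pre y n = pre x n \<longrightarrow> y \<in> A})"
  have "openin omega_omega (- D n)" for n
    unfolding openin_omega_omega D_def by (auto intro!: exI[of _ n])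
  then have "(\<Union>n. - (- D n)) \<in> Sigma0_omega \<xi>"
    using \<xi> Sigma0_omega_one_iff by (intro Sigma0_omega_I) blast
  moreover have "(\<Union>n. - (- D n)) = A"
    using A unfolding openin_omega_omega D_def by auto
  ultimately show ?thesis by simp
qed

lemma Sigma0_omega_UN:
  assumes \<xi>: "1 \<le> \<xi>" and B: "\<And>n :: nat. B n \<in> Sigma0_omega \<xi>"
  shows "(\<Union>n. B n) \<in> Sigma0_omega \<xi>"
proof (cases "\<xi> = 1")
  case True
  then show ?thesis using B Sigma0_omega_one_iff by blast
next
  case False
  then have "1 < \<xi>" using \<xi> by simp
  then have "\<forall>n. \<exists>A. B n = (\<Union>m :: nat. - A m) \<and> (\<forall>m. \<exists>\<eta>. 1 \<le> \<eta> \<and> \<eta> < \<xi> \<and> A m \<in> Sigma0_omega \<eta>)"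
    using Sigma0_omega_E[OF _ B] by metis
  then obtain A where A: "\<And>n. B n = (\<Union>m :: nat. - A n m)" "\<And>n m. \<exists>\<eta>. 1 \<le> \<eta> \<and> \<eta> < \<xi> \<and> A n m \<in> Sigma0_omega \<eta>"
    by metis
  define C where "C = (\<lambda>k. A (fst (prod_decode k)) (snd (prod_decode k)))"
  have "(\<Union>k. - C k) \<in> Sigma0_omega \<xi>" unfolding C_def using A(2) by (intro Sigma0_omega_I) blast
  moreover have "(\<Union>k. - C k) = (\<Union>n. B n)"
  proof (intro equalityI subsetI)
    fix x assume "x \<in> (\<Union>n. B n)"
    then obtain n m where "x \<notin> A n m" unfolding A(1) by auto
    then show "x \<in> (\<Union>k. - C k)"
      by (intro UN_I[of "prod_encode (n, m)"]) (auto simp: C_def)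
  qed (auto simp: A(1) C_def)
  ultimately show ?thesis by simp
qed

lemma Sigma0_omega_Un: "1 \<le> \<xi> \<Longrightarrow> A \<in> Sigma0_omega \<xi> \<Longrightarrow> B \<in> Sigma0_omega \<xi> \<Longrightarrow> A \<union> B \<in> Sigma0_omega \<xi>"
proof -
  assume "1 \<le> \<xi>" "A \<in> Sigma0_omega \<xi>" "B \<in> Sigma0_omega \<xi>"
  then have "(\<Union>n. if n = (0::nat) then A else B) \<in> Sigma0_omega \<xi>" by (intro Sigma0_omega_UN) auto
  moreover have "(\<Union>n. if n = (0::nat) then A else B) = A \<union> B" by (auto split: if_splits)
  ultimately show ?thesis by simp
qed

lemma Sigma0_omega_Int:
  assumes \<xi>: "1 \<le> \<xi>" and A: "A \<in> Sigma0_omega \<xi>" and B: "B \<in> Sigma0_omega \<xi>"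
  shows "A \<inter> B \<in> Sigma0_omega \<xi>"
proof (cases "\<xi> = 1")
  case True
  then show ?thesis using A B Sigma0_omega_one_iff by (simp add: openin_Int)
next
  case False
  then have "1 < \<xi>" using \<xi> by simp
  obtain A' \<alpha> where A': "A = (\<Union>n :: nat. - A' n)" "\<And>n. 1 \<le> \<alpha> n \<and> \<alpha> n < \<xi> \<and> A' n \<in> Sigma0_omega (\<alpha> n)"
    using Sigma0_omega_E[OF \<open>1 < \<xi>\<close> A] by metis
  obtain B' \<beta> where B': "B = (\<Union>n :: nat. - B' n)" "\<And>n. 1 \<le> \<beta> n \<and> \<beta> n < \<xi> \<and> B' n \<in> Sigma0_omega (\<beta> n)"
    using Sigma0_omega_E[OF \<open>1 < \<xi>\<close> B] by metis
  have "\<exists>\<eta>. 1 \<le> \<eta> \<and> \<eta> < \<xi> \<and> A' n \<union> B' m \<in> Sigma0_omega \<eta>" for n m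
  proof (intro exI conjI)
    show "1 \<le> max (\<alpha> n) (\<beta> m)" using A'(2)[of n] B'(2)[of m] by (simp add: max_def)
    show "max (\<alpha> n) (\<beta> m) < \<xi>" using A'(2)[of n] B'(2)[of m] by simp
    show "A' n \<union> B' m \<in> Sigma0_omega (max (\<alpha> n) (\<beta> m))"
      using A'(2)[of n] B'(2)[of m] Sigma0_omega_mono[of "\<alpha> n" "max (\<alpha> n) (\<beta> m)"] Sigma0_omega_mono[of "\<beta> m" "max (\<alpha> n) (\<beta> m)"]
        \<open>1 \<le> max (\<alpha> n) (\<beta> m)\<close>
      by (intro Sigma0_omega_Un) auto
  qed
  then have "(\<Union>m. - (A' n \<union> B' m)) \<in> Sigma0_omega \<xi>" for n by (intro Sigma0_omega_I) auto
  then have "(\<Union>n. \<Union>m. - (A' n \<union> B' m)) \<in> Sigma0_omega \<xi>" by (rule Sigma0_omega_UN[OF \<xi>])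
  moreover have "(\<Union>n. \<Union>m. - (A' n \<union> B' m)) = A \<inter> B" unfolding A'(1) B'(1) by auto
  ultimately show ?thesis by simp
qed

lemma Sigma0_omega_UNIV: "1 \<le> \<xi> \<Longrightarrow> UNIV \<in> Sigma0_omega \<xi>"
  using Sigma0_omega_mono[of 1 \<xi> UNIV] by (simp add: Sigma0_omega_one_iff openin_omega_omega)

lemma Sigma0_omega_empty: "1 \<le> \<xi> \<Longrightarrow> {} \<in> Sigma0_omega \<xi>"
  using Sigma0_omega_mono[of 1 \<xi> "{}"] by (simp add: Sigma0_omega_one_iff)

lemma Sigma0_omega_INT:
  assumes "1 \<le> \<xi>" "\<And>i. i < (n::nat) \<Longrightarrow> A i \<in> Sigma0_omega \<xi>"
  shows "{x. \<forall>i<n. x \<in> A i} \<in> Sigma0_omega \<xi>"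
  using assms(2)
proof (induction n)
  case (Suc n)
  have "{x. \<forall>i<Suc n. x \<in> A i} = {x. \<forall>i<n. x \<in> A i} \<inter> A n" by (auto simp: less_Suc_eq)
  then show ?case using Sigma0_omega_Int[OF assms(1)] Suc by simp
qed (simp add: Sigma0_omega_UNIV assms(1))

section \<open>Complete disjoint families\<close>

text \<open>The reduction property in terms of labels. The natural numbers are arranged in rows by
  \<open>prod_decode\<close>. If \<open>P j\<close> says that a point belongs to the set number
  \<open>j\<close>, then the sets with label \<open>Some k\<close> are disjoint, and they are contained in
  the unions of the rows.\<close>

definition first_row :: "(nat \<Rightarrow> bool) \<Rightarrow> nat option" where
  "first_row P = (if \<exists>j. P j then Some (fst (prod_decode (LEAST j. P j))) else None)"

text \<open>If the unions of the rows are disjoint already, then reduction does not change them.\<close>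

lemma first_row_disjoint:
  assumes U: "\<And>k. (\<exists>m. P (prod_encode (k, m))) \<longleftrightarrow> y \<in> U k"
    and disj: "\<And>i j. i \<noteq> j \<Longrightarrow> U i \<inter> U j = {}"
  shows "first_row P = Some k \<longleftrightarrow> y \<in> U k"
proof -
  have first: "y \<in> U (fst (prod_decode (LEAST j. P j)))" if "P j" for j
  proof -
    let ?j = "LEAST j. P j"
    have "P (prod_encode (fst (prod_decode ?j), snd (prod_decode ?j)))" using LeastI[of P, OF that] by simp
    then show ?thesis using U by blast
  qed
  show ?thesis
  proof
    assume "first_row P = Some k"
    then show "y \<in> U k" using first by (auto simp: first_row_def split: if_splits)
  next
    assume y: "y \<in> U k"
    then obtain m where m: "P (prod_encode (k, m))" using U by blast
    have "fst (prod_decode (LEAST j. P j)) = k" using first[OF m] y disj by blast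
    then show "first_row P = Some k" using m by (auto simp: first_row_def)
  qed
qed

lemma first_row_eq_Some:
  "first_row P = Some k \<longleftrightarrow> (\<exists>m. P (prod_encode (k, m)) \<and> (\<forall>i<prod_encode (k, m). \<not> P i))"
proof
  assume a: "first_row P = Some k"
  then obtain j where "P j" by (auto simp: first_row_def split: if_splits)
  then have "P (LEAST j. P j)" by (rule LeastI)
  moreover have "k = fst (prod_decode (LEAST j. P j))" using a by (auto simp: first_row_def split: if_splits)
  ultimately show "\<exists>m. P (prod_encode (k, m)) \<and> (\<forall>i<prod_encode (k, m). \<not> P i)"
    by (intro exI[of _ "snd (prod_decode (LEAST j. P j))"]) (auto dest: not_less_Least)
next
  assume "\<exists>m. P (prod_encode (k, m)) \<and> (\<forall>i<prod_encode (k, m). \<not> P i)"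
  then obtain m where m: "P (prod_encode (k, m))" "\<forall>i<prod_encode (k, m). \<not> P i" by blast
  then have "(LEAST j. P j) = prod_encode (k, m)"
    by (intro Least_equality) (auto simp: not_less[symmetric])
  then show "first_row P = Some k" using m(1) by (auto simp: first_row_def)
qed

text \<open>The sets \<open>{x. E x = Some k}\<close> are disjoint. The value \<open>None\<close> stands for the points
  outside all of them. That the reduction is given by a strategy with moves \<open>0\<close> and
  \<open>1\<close> makes \<open>E\<close> universal on every cube that contains Cantor space.\<close>

definition complete_family :: "omega1 \<Rightarrow> ((nat \<Rightarrow> nat) \<Rightarrow> nat option) \<Rightarrow> bool" where
  "complete_family \<xi> E \<longleftrightarrow> (\<forall>k. {x. E x = Some k} \<in> Sigma0_omega \<xi>) \<and>
    (\<forall>U. (\<forall>k. U k \<in> Sigma0_omega \<xi>) \<and> (\<forall>i j. i \<noteq> j \<longrightarrow> U i \<inter> U j = {}) \<longrightarrow>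
      (\<exists>\<sigma>. range \<sigma> \<subseteq> {0, 1} \<and> (\<forall>k y. E (strategy_map \<sigma> y) = Some k \<longleftrightarrow> y \<in> U k)))"

lemma complete_familyD:
  assumes E: "complete_family \<xi> E"
    and U: "\<And>k. U k \<in> Sigma0_omega \<xi>" "\<And>i j. i \<noteq> j \<Longrightarrow> U i \<inter> U j = {}"
  shows "\<exists>\<sigma>. range \<sigma> \<subseteq> {0, 1} \<and> (\<forall>k y. E (strategy_map \<sigma> y) = Some k \<longleftrightarrow> y \<in> U k)"
proof -
  have "(\<forall>k. U k \<in> Sigma0_omega \<xi>) \<and> (\<forall>i j. i \<noteq> j \<longrightarrow> U i \<inter> U j = {}) \<longrightarrow>
      (\<exists>\<sigma>. range \<sigma> \<subseteq> {0, 1} \<and> (\<forall>k y. E (strategy_map \<sigma> y) = Some k \<longleftrightarrow> y \<in> U k))"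
    using conjunct2[OF E[unfolded complete_family_def]] by (rule spec)
  then show ?thesis using U by simp
qed

text \<open>For \<open>\<xi> = 1\<close> the sequence \<open>x\<close> is labelled by the row of its first non-zero
  entry. For larger \<open>\<xi>\<close>, each coordinate of \<open>x\<close> stands for a set of a class
  \<open>\<eta> < \<xi>\<close>, such that every class occurs infinitely often in every row; the label is
  the row of the first coordinate that lies outside its set.\<close>

theorem complete_disjoint_family:
  assumes "1 \<le> \<xi>"
  shows "\<exists>E. complete_family \<xi> E"
  using assms
proof (induction \<xi> rule: less_induct)
  case (less \<xi>)
  show ?case
  proof (cases "\<xi> = 1")
    case True
    show ?thesis unfolding True complete_family_def
    proof (intro exI[of _ "\<lambda>x :: nat \<Rightarrow> nat. first_row (\<lambda>j. x j \<noteq> 0)"] conjI allI impI)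
      fix k
      have "openin omega_omega {x. first_row (\<lambda>j. x j \<noteq> 0) = Some k}"
        unfolding openin_omega_omega
      proof
        fix x :: "nat \<Rightarrow> nat" assume "x \<in> {x. first_row (\<lambda>j. x j \<noteq> 0) = Some k}"
        then obtain m where m: "x (prod_encode (k, m)) \<noteq> 0 \<and> (\<forall>i<prod_encode (k, m). \<not> x i \<noteq> 0)"
          unfolding mem_Collect_eq first_row_eq_Some by blast
        have "first_row (\<lambda>j. y j \<noteq> 0) = Some k"
          if y: "pre y (Suc (prod_encode (k, m))) = pre x (Suc (prod_encode (k, m)))" for y
          unfolding first_row_eq_Some using m y by (intro exI[of _ m]) (simp add: pre_eq_iff)
        then show "\<exists>n. \<forall>y. pre y n = pre x n \<longrightarrow> y \<in> {x. first_row (\<lambda>j. x j \<noteq> 0) = Some k}" by blast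
      qed
      then show "{x. first_row (\<lambda>j. x j \<noteq> 0) = Some k} \<in> Sigma0_omega 1" by (simp add: Sigma0_omega_one_iff)
    next
      fix U assume U: "(\<forall>k. U k \<in> Sigma0_omega 1) \<and> (\<forall>i j :: nat. i \<noteq> j \<longrightarrow> U i \<inter> U j = {})"
      \<comment> \<open>Play \<open>1\<close> at a position in row \<open>k\<close> as soon as the moves seen so far decide
        that \<open>y \<in> U k\<close>.\<close>
      define \<sigma> :: "nat list \<Rightarrow> nat" where
        "\<sigma> = (\<lambda>s. of_bool (\<forall>y. pre y (length s) = s \<longrightarrow> y \<in> U (fst (prod_decode (length s - 1)))))"
      have "first_row (\<lambda>j. strategy_map \<sigma> y j \<noteq> 0) = Some k \<longleftrightarrow> y \<in> U k" for k y
      proof (rule first_row_disjoint)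
        fix k
        show "(\<exists>m. strategy_map \<sigma> y (prod_encode (k, m)) \<noteq> 0) \<longleftrightarrow> y \<in> U k"
        proof
          assume "\<exists>m. strategy_map \<sigma> y (prod_encode (k, m)) \<noteq> 0"
          then show "y \<in> U k" by (auto simp: strategy_map_def \<sigma>_def)
        next
          assume y: "y \<in> U k"
          have "openin omega_omega (U k)" using U Sigma0_omega_one_iff by blast
          then obtain n where n: "\<And>w. pre w n = pre y n \<Longrightarrow> w \<in> U k"
            using y unfolding openin_omega_omega by blast
          have "n \<le> Suc (prod_encode (k, n))" using le_prod_encode_2[of n k] by simp
          then have "\<forall>w. pre w (Suc (prod_encode (k, n))) = pre y (Suc (prod_encode (k, n))) \<longrightarrow> w \<in> U k"
            using n pre_eq_mono by blast
          then have "strategy_map \<sigma> y (prod_encode (k, n)) \<noteq> 0"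
            unfolding strategy_map_def \<sigma>_def by simp
          then show "\<exists>m. strategy_map \<sigma> y (prod_encode (k, m)) \<noteq> 0" by blast
        qed
      qed (use U in blast)
      moreover have "range \<sigma> \<subseteq> {0, 1}" by (auto simp: \<sigma>_def)
      ultimately show "\<exists>\<sigma>. range \<sigma> \<subseteq> {0, 1} \<and>
          (\<forall>k y. first_row (\<lambda>j. strategy_map \<sigma> y j \<noteq> 0) = Some k \<longleftrightarrow> y \<in> U k)" by blast
    qed
  next
    case False
    then have \<xi>: "1 < \<xi>" using less.prems by simp
    define I where "I = {\<eta>. 1 \<le> \<eta> \<and> \<eta> < \<xi>}"
    have "I \<noteq> {}" using \<xi> by (auto simp: I_def)
    moreover have "countable I"
      by (rule countable_subset[OF _ countable_below_omega1[of \<xi>]]) (auto simp: I_def)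
    ultimately obtain en :: "nat \<Rightarrow> omega1" where en: "range en = I"
      using range_from_nat_into by metis
    have enI: "1 \<le> en a" "en a < \<xi>" for a using en unfolding I_def by auto
    have "\<exists>E. complete_family (en a) E" for a
      using less.IH[OF enI(2) enI(1)] .
    then obtain E where E: "\<And>a. complete_family (en a) (E a)" by metis
    have E1: "{x. E a x = Some k} \<in> Sigma0_omega (en a)" for a k
      using E unfolding complete_family_def by blast
    \<comment> \<open>The label \<open>Some 0\<close> gives a complete set of its class: apply completeness to the sequence
      \<open>T, {}, {}, \<dots>\<close>\<close>
    have V: "\<exists>\<sigma>. range \<sigma> \<subseteq> {0, 1} \<and> (\<forall>y. E a (strategy_map \<sigma> y) = Some 0 \<longleftrightarrow> y \<in> T)" if "T \<in> Sigma0_omega (en a)" for a T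
    proof -
      let ?U = "\<lambda>k :: nat. if k = 0 then T else {}"
      have "\<exists>\<sigma>. range \<sigma> \<subseteq> {0, 1} \<and> (\<forall>k y. E a (strategy_map \<sigma> y) = Some k \<longleftrightarrow> y \<in> ?U k)"
        by (rule complete_familyD[OF E]) (use that Sigma0_omega_empty[OF enI(1)] in auto)
      then obtain \<sigma> where "range \<sigma> \<subseteq> {0, 1}" "\<And>k y. E a (strategy_map \<sigma> y) = Some k \<longleftrightarrow> y \<in> ?U k"
        by blast
      from this(1) this(2)[of _ 0] show ?thesis by (intro exI[of _ \<sigma>]) simp
    qed
    \<comment> \<open>The number \<open>prod_encode (k, prod_encode (a, b))\<close> stands for set number \<open>b\<close> in
      row \<open>k\<close>, provided that its class is \<open>en a\<close>.\<close>
    define lv where "lv = (\<lambda>j. fst (prod_decode (snd (prod_decode j))))"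
    define P where "P = (\<lambda>x j. E (lv j) (coord j x) \<noteq> Some 0)"
    have P0: "{x. \<not> P x j} \<in> Sigma0_omega (en (lv j))" for j
      using Sigma0_omega_vimage[OF cont_coord E1] by (simp add: P_def)
    show ?thesis unfolding complete_family_def
    proof (intro exI[of _ "\<lambda>x. first_row (P x)"] conjI allI impI)
      fix k
      have "{x. first_row (P x) = Some k} =
        (\<Union>m. - {x. \<not> P x (prod_encode (k, m))} \<inter> {x. \<forall>i<prod_encode (k, m). x \<in> {x. \<not> P x i}})"
        by (auto simp: first_row_eq_Some)
      also have "\<dots> \<in> Sigma0_omega \<xi>"
      proof (intro Sigma0_omega_UN Sigma0_omega_Int Sigma0_omega_INT less.prems)
        show "- {x. \<not> P x (prod_encode (k, m))} \<in> Sigma0_omega \<xi>" for m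
          by (rule Sigma0_omega_Compl[OF enI P0])
        show "{x. \<not> P x i} \<in> Sigma0_omega \<xi>" for i
          by (rule Sigma0_omega_mono[OF enI(1) order.strict_implies_order[OF enI(2)] P0])
      qed
      finally show "{x. first_row (P x) = Some k} \<in> Sigma0_omega \<xi>" .
    next
      fix U assume U: "(\<forall>k. U k \<in> Sigma0_omega \<xi>) \<and> (\<forall>i j :: nat. i \<noteq> j \<longrightarrow> U i \<inter> U j = {})"
      have "\<exists>A \<eta>. U k = (\<Union>n :: nat. - A n) \<and> (\<forall>n. \<eta> n \<in> I \<and> A n \<in> Sigma0_omega (\<eta> n))" for k
      proof -
        have "U k \<in> Sigma0_omega \<xi>" using U by blast
        then obtain A \<eta> where "U k = (\<Union>n :: nat. - A n)" "\<And>n. 1 \<le> \<eta> n \<and> \<eta> n < \<xi> \<and> A n \<in> Sigma0_omega (\<eta> n)"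
          by (rule Sigma0_omega_E[OF \<xi>]) blast
        then show ?thesis unfolding I_def by blast
      qed
      then obtain A \<eta> where A: "\<And>k. U k = (\<Union>n :: nat. - A k n)" "\<And>k n. \<eta> k n \<in> I" "\<And>k n. A k n \<in> Sigma0_omega (\<eta> k n)"
        by metis
      \<comment> \<open>Where the class does not match, the full set contributes nothing to the union of the complements.\<close>
      define T where "T = (\<lambda>j. case prod_decode j of (k, m) \<Rightarrow> case prod_decode m of (a, b) \<Rightarrow>
        if \<eta> k b = en a then A k b else UNIV)"
      have "T j \<in> Sigma0_omega (en (lv j))" for j
      proof -
        obtain k m where j: "prod_decode j = (k, m)" by fastforce
        obtain a b where m: "prod_decode m = (a, b)" by fastforce
        show ?thesis
          using A(3)[of k b] Sigma0_omega_UNIV[OF enI(1), of a]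
          by (cases "\<eta> k b = en a") (simp_all add: T_def lv_def j m)
      qed
      then have "\<forall>j. \<exists>\<sigma>. range \<sigma> \<subseteq> {0, 1} \<and> (\<forall>y. E (lv j) (strategy_map \<sigma> y) = Some 0 \<longleftrightarrow> y \<in> T j)"
        using V by blast
      then obtain \<sigma> where \<sigma>: "\<And>j. range (\<sigma> j) \<subseteq> {0, 1}" "\<And>j y. E (lv j) (strategy_map (\<sigma> j) y) = Some 0 \<longleftrightarrow> y \<in> T j"
        by metis
      have P: "P (strategy_map (combine \<sigma>) y) j \<longleftrightarrow> y \<notin> T j" for y j
        by (simp add: P_def coord_strategy_map_combine \<sigma>(2))
      have "first_row (P (strategy_map (combine \<sigma>) y)) = Some k \<longleftrightarrow> y \<in> U k" for k y
      proof (rule first_row_disjoint)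
        fix k
        show "(\<exists>m. P (strategy_map (combine \<sigma>) y) (prod_encode (k, m))) \<longleftrightarrow> y \<in> U k"
        proof
          assume "\<exists>m. P (strategy_map (combine \<sigma>) y) (prod_encode (k, m))"
          then obtain m where m: "y \<notin> T (prod_encode (k, m))" unfolding P by blast
          obtain a b where "prod_decode m = (a, b)" by fastforce
          then show "y \<in> U k" using m unfolding A(1) by (auto simp: T_def split: if_splits)
        next
          assume "y \<in> U k"
          then obtain b where b: "y \<notin> A k b" unfolding A(1) by blast
          obtain a where "en a = \<eta> k b" using A(2)[of k b] en by (metis imageE)
          then have "y \<notin> T (prod_encode (k, prod_encode (a, b)))" using b by (simp add: T_def)
          then show "\<exists>m. P (strategy_map (combine \<sigma>) y) (prod_encode (k, m))" unfolding P by blast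
        qed
      qed (use U in blast)
      moreover have "range (combine \<sigma>) \<subseteq> {0, 1}" by (rule range_combine[OF \<sigma>(1)])
      ultimately show "\<exists>\<sigma>. range \<sigma> \<subseteq> {0, 1} \<and> (\<forall>k y. first_row (P (strategy_map \<sigma> y)) = Some k \<longleftrightarrow> y \<in> U k)"
        by blast
    qed
  qed
qed

lemma universal_complete_family:
  assumes "complete_family \<xi> E"
  shows "universal {0, 1} E"
  unfolding universal_def
proof (intro allI impI)
  fix f assume f: "cont f"
  have "{x. E x = Some k} \<in> Sigma0_omega \<xi>" for k using assms unfolding complete_family_def by blast
  then have "{y. f y \<in> {x. E x = Some k}} \<in> Sigma0_omega \<xi>" for k by (rule Sigma0_omega_vimage[OF f])
  then have "\<exists>\<sigma>. range \<sigma> \<subseteq> {0, 1} \<and> (\<forall>k y. E (strategy_map \<sigma> y) = Some k \<longleftrightarrow> y \<in> {y. f y \<in> {x. E x = Some k}})"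
    by (intro complete_familyD[OF assms]) auto
  then obtain \<sigma> where "range \<sigma> \<subseteq> {0, 1}" "\<And>k y. E (strategy_map \<sigma> y) = Some k \<longleftrightarrow> E (f y) = Some k" by auto
  then have "E (f y) = E (strategy_map \<sigma> y)" for y by (metis not_None_eq)
  then show "\<exists>\<sigma>. range \<sigma> \<subseteq> {0, 1} \<and> (\<forall>y. E (f y) = E (strategy_map \<sigma> y))"
    using \<open>range \<sigma> \<subseteq> {0, 1}\<close> by blast
qed

section \<open>The two kinds of spaces\<close>

text \<open>\<open>A\<close> is Wadge equivalent to a set that is universal on the cube, by a reduction with values in
  the cube.\<close>

definition has_cube_model :: "nat set \<Rightarrow> (nat \<Rightarrow> nat) set \<Rightarrow> bool" where
  "has_cube_model S A \<longleftrightarrow> (\<exists>f h B. cont f \<and> cont h \<and> (\<forall>x. f x \<in> cube S) \<and>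
     (\<forall>x. x \<in> A \<longleftrightarrow> f x \<in> B) \<and> (\<forall>y. y \<in> B \<longleftrightarrow> h y \<in> A) \<and> universal S (\<lambda>x. x \<in> B))"

text \<open>The dichotomy: either \<open>X\<close> has a non-empty closed subset that is nowhere locally compact, and
  then Baire space works without changing \<open>A\<close>, or all sets are moved to Cantor space. The same
  cube serves for all \<open>A\<close>, as is needed to combine countably many classes.\<close>

lemma (in determined_algebra) complete_sets_on_cube:
  assumes X: "closedin omega_omega X" "uncountable X"
    and R: "cont R" "\<And>x. R x \<in> X" "\<And>x. x \<in> X \<Longrightarrow> R x = x"
  shows "\<exists>S e q. {0, 1} \<subseteq> S \<and> cont e \<and> cont q \<and> (\<forall>x. e x \<in> X) \<and> (\<forall>w. q w \<in> cube S) \<and>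
    (\<forall>x\<in>cube S. q (e x) = x) \<and>
    (\<forall>A\<in>\<S>. \<not> self_dual A \<and> (\<forall>x. R x \<in> A \<longleftrightarrow> x \<in> A) \<longrightarrow>
      has_cube_model S A)"
proof (cases "\<exists>F. F \<subseteq> X \<and> closedin omega_omega F \<and> F \<noteq> {} \<and> (\<forall>z\<in>F. \<forall>n. \<not> bounded_piece F (pre z n))")
  case True
  then obtain F where F: "F \<subseteq> X" "closedin omega_omega F" "F \<noteq> {}" "\<And>z n. z \<in> F \<Longrightarrow> \<not> bounded_piece F (pre z n)"
    by blast
  obtain e q where "cont e" "cont q" "\<forall>x. e x \<in> X" "\<forall>w. q w \<in> cube UNIV" "\<forall>x\<in>cube UNIV. q (e x) = x"
    using Baire_retract_of_unbounded[OF F(2-4)] F(1) by (metis subsetD)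
  moreover have "has_cube_model UNIV A" if A: "A \<in> \<S>" "\<not> self_dual A" for A
    unfolding has_cube_model_def using universal_if_not_self_dual[OF A, of UNIV] cont_id
    by (intro exI[of _ "\<lambda>x. x"] exI[of _ A]) (simp add: cube_def)
  ultimately show ?thesis
    by (intro exI[of _ UNIV] exI[of _ e] exI[of _ q]) simp
next
  case False
  then have bdd: "\<And>F. F \<subseteq> X \<Longrightarrow> closedin omega_omega F \<Longrightarrow> F \<noteq> {} \<Longrightarrow> \<exists>z\<in>F. \<exists>n. bounded_piece F (pre z n)"
    by blast
  let ?\<rho> = "proj {0, 1}"
  have \<rho>\<rho>: "?\<rho> (?\<rho> x) = ?\<rho> x" for x by (rule proj_cube[OF proj_in_cube]) simp
  obtain e q where eq: "cont e" "cont q" "\<forall>x. e x \<in> X" "\<forall>w. q w \<in> cube {0, 1}" "\<forall>x\<in>cube {0, 1}. q (e x) = x"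
    using cantor_retract_of_uncountable[OF X] by blast
  have "has_cube_model {0, 1} A"
    if A: "A \<in> \<S>" "\<not> self_dual A" and inv: "\<And>x. R x \<in> A \<longleftrightarrow> x \<in> A" for A
  proof -
    obtain f h where f: "cont f" and h: "cont h" and fh: "\<And>x. x \<in> A \<longleftrightarrow> h (?\<rho> (f x)) \<in> A"
      using cantor_representation[OF A X(1) R inv bdd] by blast
    define B where "B = {y. h (?\<rho> y) \<in> A}"
    have h': "cont (\<lambda>y. h (?\<rho> y))" by (rule cont_comp[OF h cont_proj])
    have "B \<in> \<S>" unfolding B_def by (rule vimage_S[OF h' A(1)])
    moreover have "\<not> self_dual B"
    proof
      assume "self_dual B"
      then obtain g where g: "cont g" "\<And>x. x \<in> B \<longleftrightarrow> g x \<notin> B" unfolding self_dual_def by blast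
      have "x \<in> A \<longleftrightarrow> h (?\<rho> (g (f x))) \<notin> A" for x using fh[of x] g(2)[of "f x"] by (simp add: B_def)
      moreover have "cont (\<lambda>x. h (?\<rho> (g (f x))))" by (rule cont_comp[OF h' cont_comp[OF g(1) f]])
      ultimately show False using A(2) unfolding self_dual_def by blast
    qed
    moreover have "?\<rho> x \<in> B \<longleftrightarrow> x \<in> B" for x unfolding B_def mem_Collect_eq \<rho>\<rho> ..
    ultimately have "universal {0, 1} (\<lambda>x. x \<in> B)" by (intro universal_if_not_self_dual) simp_all
    moreover have "x \<in> A \<longleftrightarrow> ?\<rho> (f x) \<in> B" for x unfolding B_def mem_Collect_eq \<rho>\<rho> by (rule fh)
    moreover have "y \<in> B \<longleftrightarrow> h (?\<rho> y) \<in> A" for y by (simp add: B_def)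
    moreover have "?\<rho> x \<in> cube {0, 1}" for x by (rule proj_in_cube) simp
    ultimately show ?thesis unfolding has_cube_model_def using cont_comp[OF cont_proj f] h' by blast
  qed
  then show ?thesis using eq
    by (intro exI[of _ "{0, 1}"] exI[of _ e] exI[of _ q]) blast
qed

section \<open>Wadge classes under Hausdorff operations\<close>

lemma sep_metrizable_omega_omega: "sep_metrizable omega_omega"
proof -
  have "metrizable_space omega_omega"
    unfolding omega_omega_def metrizable_space_product_topology by (auto simp: metrizable_space_discrete_topology)
  moreover have "separable_space omega_omega"
    unfolding separable_space_def
  proof (intro exI conjI)
    let ?C = "range (\<lambda>s n. if n < length s then s ! n else 0 :: nat)"
    show "countable ?C" by simp
    show "?C \<subseteq> topspace omega_omega" by simp
    have "x \<in> omega_omega closure_of ?C" for x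
      unfolding in_closure_of
    proof (intro conjI allI impI)
      fix T assume "x \<in> T \<and> openin omega_omega T"
      then obtain n where "\<And>y. pre y n = pre x n \<Longrightarrow> y \<in> T" unfolding openin_omega_omega by blast
      then have "(\<lambda>k. if k < length (pre x n) then pre x n ! k else 0) \<in> T" by (simp add: pre_eq_iff)
      then show "\<exists>y. y \<in> ?C \<and> y \<in> T" by blast
    qed simp
    then show "omega_omega closure_of ?C = topspace omega_omega" by auto
  qed
  ultimately show ?thesis by (simp add: sep_metrizable_def)
qed

lemma pointclass_on_vimage:
  assumes \<Sigma>: "topological_pointclass \<Sigma>" and Z: "sep_metrizable Z"
    and f: "continuous_map omega_omega Z f" and A: "A \<in> pointclass_on \<Sigma> Z"
  shows "{x. f x \<in> A} \<in> \<Sigma> omega_omega"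
proof -
  obtain W h where AZ: "A \<subseteq> topspace Z" and h: "homeomorphic_map Z W h" and hA: "h ` A \<in> \<Sigma> W"
    using A unfolding pointclass_on_def by blast
  have "sep_metrizable W" using homeomorphic_map_sep_metrizable[OF h] Z by simp
  moreover have "continuous_map omega_omega W (h \<circ> f)"
    using f homeomorphic_imp_continuous_map[OF h] by (rule continuous_map_compose)
  ultimately have "preimage omega_omega (h \<circ> f) (h ` A) \<in> \<Sigma> omega_omega"
    using \<Sigma> hA sep_metrizable_omega_omega unfolding topological_pointclass_def by blast
  moreover have "f x \<in> topspace Z" for x using f by (auto simp: continuous_map_def)
  then have "preimage omega_omega (h \<circ> f) (h ` A) = {x. f x \<in> A}"
    using homeomorphic_imp_injective_map[OF h] AZ by (auto simp: inj_on_image_mem_iff)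
  ultimately show ?thesis by simp
qed

lemma selfdual_wadge_class:
  assumes A: "A \<subseteq> topspace Z" and g: "continuous_map Z Z g" "\<And>z. z \<in> topspace Z \<Longrightarrow> z \<in> A \<longleftrightarrow> g z \<notin> A"
  shows "selfdual Z {preimage Z f A | f. continuous_map Z Z f}"
proof -
  have e: "preimage Z f A = topspace Z - preimage Z (g \<circ> f) A"
    if "continuous_map Z Z f" for f
  proof -
    have "f z \<in> topspace Z" if "z \<in> topspace Z" for z
      using \<open>continuous_map Z Z f\<close> that by (auto simp: continuous_map_def)
    then show ?thesis using g(2) by auto
  qed
  have c: "continuous_map Z Z (g \<circ> f)" if "continuous_map Z Z f" for f
    using that g(1) by (rule continuous_map_compose)
  have e': "topspace Z - preimage Z f A = preimage Z (g \<circ> f) A" if "continuous_map Z Z f" for f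
    using e[OF that] by auto
  let ?\<Gamma> = "{preimage Z f A | f. continuous_map Z Z f}"
  show ?thesis
    unfolding selfdual_def dual_class_def
  proof (intro equalityI subsetI)
    fix B assume "B \<in> ?\<Gamma>"
    then obtain f where f: "continuous_map Z Z f" "B = preimage Z f A" by blast
    then have "B = topspace Z - preimage Z (g \<circ> f) A" using e by blast
    moreover have "preimage Z (g \<circ> f) A \<in> ?\<Gamma>" using c[OF f(1)] by blast
    ultimately show "B \<in> {topspace Z - C | C. C \<in> ?\<Gamma>}" by blast
  next
    fix B assume "B \<in> {topspace Z - C | C. C \<in> ?\<Gamma>}"
    then obtain f where f: "continuous_map Z Z f" "B = topspace Z - preimage Z f A" by blast
    then have "B = preimage Z (g \<circ> f) A" using e' by simp
    then show "B \<in> ?\<Gamma>" using c[OF f(1)] by blast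
  qed
qed

lemma determined_algebra_pointclass:
  assumes \<Sigma>: "nice_pointclass \<Sigma>" and det: "Det (\<Sigma> omega_omega)"
  shows "determined_algebra (\<Sigma> omega_omega)"
proof (rule determined_algebra.intro)
  have "algebra (topspace omega_omega) (\<Sigma> omega_omega)"
    using \<Sigma> sep_metrizable_omega_omega unfolding nice_pointclass_def by blast
  then show "algebra UNIV (\<Sigma> omega_omega)" by simp
  fix f B assume f: "cont f" and B: "B \<in> \<Sigma> omega_omega"
  have "preimage omega_omega f B \<in> \<Sigma> omega_omega"
    using \<Sigma> f B sep_metrizable_omega_omega unfolding nice_pointclass_def topological_pointclass_def by blast
  then show "{x. f x \<in> B} \<in> \<Sigma> omega_omega" by simp
next
  show "determined B" if "B \<in> \<Sigma> omega_omega" for B using det that by (simp add: Det_def)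
qed

theorem corollary3p39:
  fixes \<Sigma> :: pointclass and D :: "nat set set" and Z :: "'a topology" and \<xi> :: omega1
    and \<Gamma>s :: "nat \<Rightarrow> 'a set set"
  assumes "nice_pointclass \<Sigma>"
    and "Det (\<Sigma> omega_omega)"
    and "polish Z" and "zero_dimensional Z" and "uncountable (topspace Z)"
    and "1 \<le> \<xi>"
    and "\<And>n. \<Gamma>s n \<in> NSD_in \<Sigma> Z"
  shows "{hausdorff_op Z D B | B.
            (\<forall>k. B (2 * k) \<in> \<Gamma>s k) \<and>
            (\<forall>k. B (2 * k + 1) \<in> Sigma0 \<xi> Z) \<and>
            (\<forall>i j. i \<noteq> j \<longrightarrow> B (2 * i + 1) \<inter> B (2 * j + 1) = {})} \<in> NSD Z"
proof -
  interpret determined_algebra "\<Sigma> omega_omega"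
    by (rule determined_algebra_pointclass[OF assms(1,2)])
  have top\<Sigma>: "topological_pointclass \<Sigma>" using assms(1) by (simp add: nice_pointclass_def)
  have sepZ: "sep_metrizable Z"
    using assms(3) completely_metrizable_imp_metrizable_space by (auto simp: polish_def sep_metrizable_def)
  obtain i r where i: "continuous_map Z omega_omega i" and r: "continuous_map omega_omega Z r"
    and ri: "\<And>z. z \<in> topspace Z \<Longrightarrow> r (i z) = z"
    using retract_of_Baire_space[OF assms(3,4)] by blast
  have rZ: "r x \<in> topspace Z" for x using r by (auto simp: continuous_map_def)
  define X where "X = i ` topspace Z"
  define R where "R = (\<lambda>x. i (r x))"
  have R: "cont R" unfolding R_def using continuous_map_compose[OF r i] by (simp add: comp_def)
  have RX: "R x \<in> X" for x by (simp add: R_def X_def rZ)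
  have Rid: "R x = x" if "x \<in> X" for x using that ri by (auto simp: R_def X_def)
  have X_closed: "closedin omega_omega X"
    unfolding closedin_omega_omega
  proof (intro allI impI)
    fix x assume *: "\<forall>n. \<exists>y\<in>X. pre y n = pre x n"
    have "R x n = x n" for n
    proof -
      obtain m where m: "Suc n \<le> m" "\<And>y. pre y m = pre x m \<Longrightarrow> pre (R y) (Suc n) = pre (R x) (Suc n)"
        using cont_pre[OF R] by blast
      obtain y where y: "y \<in> X" "pre y m = pre x m" using * by blast
      have "pre (R x) (Suc n) = pre x (Suc n)"
        using m(2)[OF y(2)] pre_eq_mono[OF y(2) m(1)] Rid[OF y(1)] by simp
      then show ?thesis by (simp add: pre_eq_iff)
    qed
    then have "R x = x" by (rule ext)
    then show "x \<in> X" using RX by metis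
  qed
  have X_unc: "uncountable X"
  proof
    assume "countable X"
    then have "countable (r ` X)" by (rule countable_image)
    moreover have "r ` X = topspace Z" unfolding X_def using ri by (force simp: image_image)
    ultimately show False using assms(5) by simp
  qed
  have "\<exists>S e q. {0, 1} \<subseteq> S \<and> cont e \<and> cont q \<and> (\<forall>x. e x \<in> X) \<and> (\<forall>w. q w \<in> cube S) \<and>
    (\<forall>x\<in>cube S. q (e x) = x) \<and>
    (\<forall>A\<in>\<Sigma> omega_omega. \<not> self_dual A \<and> (\<forall>x. R x \<in> A \<longleftrightarrow> x \<in> A) \<longrightarrow> has_cube_model S A)"
    by (rule complete_sets_on_cube[OF X_closed X_unc R RX Rid])
  then obtain S e q where Seq: "{0, 1} \<subseteq> S \<and> cont e \<and> cont q \<and> (\<forall>x. e x \<in> X) \<and> (\<forall>w. q w \<in> cube S) \<and>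
    (\<forall>x\<in>cube S. q (e x) = x) \<and>
    (\<forall>A\<in>\<Sigma> omega_omega. \<not> self_dual A \<and> (\<forall>x. R x \<in> A \<longleftrightarrow> x \<in> A) \<longrightarrow> has_cube_model S A)"
    by (elim exE)
  then have S: "{0, 1} \<subseteq> S" and e: "cont e" and q: "cont q"
    and eX: "\<And>x. e x \<in> X" and qe: "\<And>x. x \<in> cube S \<Longrightarrow> q (e x) = x"
    by simp_all
  have complete: "has_cube_model S A"
    if "A \<in> \<Sigma> omega_omega" "\<not> self_dual A" "\<And>x. R x \<in> A \<longleftrightarrow> x \<in> A" for A
    using Seq that by simp
  have qhat: "continuous_map Z omega_omega (\<lambda>z. q (i z))" by (rule cont_comp'[OF i q])
  have ehat: "continuous_map omega_omega Z (\<lambda>x. r (e x))"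
    using continuous_map_compose[OF e r] by (simp add: comp_def)
  have qe_hat: "q (i (r (e x))) = x" if "x \<in> cube S" for x
    using qe[OF that] Rid[OF eX] by (simp add: R_def)

  define model where "model = (\<lambda>k A B f h. 
      \<Gamma>s k = {preimage Z f A | f. continuous_map Z Z f} \<and>
      continuous_map Z omega_omega f \<and> continuous_map omega_omega Z h \<and> (\<forall>z. f z \<in> cube S) \<and>
      (\<forall>z\<in>topspace Z. z \<in> A \<longleftrightarrow> f z \<in> B) \<and> (\<forall>y. y \<in> B \<longleftrightarrow> h y \<in> A) \<and> universal S (\<lambda>x. x \<in> B))"
  have "\<exists>A B f h. model k A B f h" for k
  proof -
    have "\<Gamma>s k \<in> NSD Z" and sub: "\<Gamma>s k \<subseteq> pointclass_on \<Sigma> Z" using assms(7)[of k] by (auto simp: NSD_in_def)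
    then obtain A where A: "A \<subseteq> topspace Z" and \<Gamma>: "\<Gamma>s k = {preimage Z f A | f. continuous_map Z Z f}"
      and nsd: "\<not> selfdual Z (\<Gamma>s k)"
      unfolding NSD_def wadge_class_def by blast
    have "preimage Z id A \<in> \<Gamma>s k" unfolding \<Gamma> using continuous_map_id by blast
    moreover have "preimage Z id A = A" using A by auto
    ultimately have "A \<in> pointclass_on \<Sigma> Z" using sub by auto
    then have 1: "{x. r x \<in> A} \<in> \<Sigma> omega_omega" by (rule pointclass_on_vimage[OF top\<Sigma> sepZ r])
    have 2: "\<not> self_dual {x. r x \<in> A}"
    proof
      assume "self_dual {x. r x \<in> A}"
      then obtain g where g: "cont g" "\<And>x. r x \<in> A \<longleftrightarrow> r (g x) \<notin> A" unfolding self_dual_def by auto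
      have "continuous_map Z Z (\<lambda>z. r (g (i z)))"
        using continuous_map_compose[OF cont_comp'[OF i g(1)] r] by (simp add: comp_def)
      moreover have "z \<in> A \<longleftrightarrow> r (g (i z)) \<notin> A" if "z \<in> topspace Z" for z
        using g(2)[of "i z"] ri[OF that] by simp
      ultimately show False using selfdual_wadge_class[OF A] nsd unfolding \<Gamma> by blast
    qed
    have 3: "R x \<in> {x. r x \<in> A} \<longleftrightarrow> x \<in> {x. r x \<in> A}" for x by (simp add: R_def ri rZ)
    obtain f h B where f: "cont f" and h: "cont h" and fS: "\<And>x. f x \<in> cube S" and fB: "\<And>x. x \<in> {x. r x \<in> A} \<longleftrightarrow> f x \<in> B"
      and hB: "\<And>y. y \<in> B \<longleftrightarrow> h y \<in> {x. r x \<in> A}" and B: "universal S (\<lambda>x. x \<in> B)"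
      using complete[OF 1 2 3] unfolding has_cube_model_def by blast
    show ?thesis
      unfolding model_def
    proof (intro exI conjI ballI allI)
      show "continuous_map Z omega_omega (\<lambda>z. f (i z))" by (rule cont_comp'[OF i f])
      show "continuous_map omega_omega Z (\<lambda>y. r (h y))"
        using continuous_map_compose[OF h r] by (simp add: comp_def)
      show "z \<in> A \<longleftrightarrow> f (i z) \<in> B" if "z \<in> topspace Z" for z using fB[of "i z"] ri[OF that] by simp
      show "y \<in> B \<longleftrightarrow> r (h y) \<in> A" for y using hB[of y] by simp
    qed (fact \<Gamma> B fS)+
  qed
  then obtain A B f h where model: "\<And>k. model k (A k) (B k) (f k) (h k)"
    by metis
  have \<Gamma>s: "\<Gamma>s k = {preimage Z f (A k) | f. continuous_map Z Z f}" for k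
    using model[of k] unfolding model_def by blast
  have \<Gamma>sI: "preimage Z g (A k) \<in> \<Gamma>s k" if "continuous_map Z Z g" for g k
    unfolding \<Gamma>s using that by blast
  have f: "continuous_map Z omega_omega (f k)" and h: "continuous_map omega_omega Z (h k)" for k
    using model[of k] unfolding model_def by simp_all
  have fS: "f k z \<in> cube S" for k z using model[of k] unfolding model_def by simp
  have fB: "z \<in> A k \<longleftrightarrow> f k z \<in> B k" if "z \<in> topspace Z" for k z
    using model[of k] that unfolding model_def by simp
  have hB: "y \<in> B k \<longleftrightarrow> h k y \<in> A k" for k y using model[of k] unfolding model_def by simp
  have B: "universal S (\<lambda>x. x \<in> B k)" for k using model[of k] unfolding model_def by (elim conjE)
  obtain E where E: "complete_family \<xi> E" using complete_disjoint_family[OF assms(6)] by blast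

  \<comment> \<open>Coordinate \<open>2 * k\<close> controls membership in the set from \<open>\<Gamma>s k\<close>; coordinate
    \<open>1\<close> controls all the disjoint sets at once.\<close>
  define \<alpha> where "\<alpha> = (\<lambda>n x. if n = 1 then E x else if even n \<and> x \<in> B (n div 2) then Some 0 else None)"
  define W where "W = {x. {n. if even n then \<alpha> n (coord n x) = Some 0 else \<alpha> 1 (coord 1 x) = Some (n div 2)} \<in> D}"
  have "universal S (\<alpha> n)" for n
  proof -
    consider "n = 1" | "n \<noteq> 1" "even n" | "n \<noteq> 1" "odd n" by blast
    then show ?thesis
    proof cases
      case 1
      then have "\<alpha> n = E" by (simp add: \<alpha>_def)
      then show ?thesis using universal_mono[OF universal_complete_family[OF E] S] by simp
    next
      case 2
      then have "\<alpha> n = (\<lambda>x. if x \<in> B (n div 2) then Some 0 else None)" by (auto simp: \<alpha>_def)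
      moreover have "universal S (\<lambda>x. if x \<in> B (n div 2) then Some 0 else None)"
        by (rule universal_comp[OF B, of "\<lambda>b. if b then Some 0 else None"])
      ultimately show ?thesis by simp
    next
      case 3
      then have "\<alpha> n = (\<lambda>x. None)" by (auto simp: \<alpha>_def)
      then show ?thesis using universal_const[of 0 S] S by simp
    qed
  qed
  then have "universal S (\<lambda>x n. \<alpha> n (coord n x))" by (rule universal_prod)
  from universal_comp[OF this, of "\<lambda>a. {n. if even n then a n = Some 0 else a 1 = Some (n div 2)} \<in> D"]
  have W: "universal S (\<lambda>x. x \<in> W)" by (simp add: W_def)
  have W_iff: "x \<in> W \<longleftrightarrow> {n. if even n then coord n x \<in> B (n div 2) else E (coord 1 x) = Some (n div 2)} \<in> D" for x
  proof -
    have "(if even n then \<alpha> n (coord n x) = Some 0 else \<alpha> 1 (coord 1 x) = Some (n div 2)) =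
        (if even n then coord n x \<in> B (n div 2) else E (coord 1 x) = Some (n div 2))" for n
      by (auto simp: \<alpha>_def)
    then show ?thesis by (simp add: W_def)
  qed
  define WZ where "WZ = preimage Z (\<lambda>z. q (i z)) W"
  let ?G = "{hausdorff_op Z D B | B.
            (\<forall>k. B (2 * k) \<in> \<Gamma>s k) \<and>
            (\<forall>k. B (2 * k + 1) \<in> Sigma0 \<xi> Z) \<and>
            (\<forall>i j. i \<noteq> j \<longrightarrow> B (2 * i + 1) \<inter> B (2 * j + 1) = {})}"
  \<comment> \<open>The class consists of the continuous preimages of \<open>W\<close>. One half is the fact that all
    constraints are inherited by preimages, the other one the completeness of the ingredients of
    \<open>W\<close>.\<close>
  have vimage_W: "preimage Z g W \<in> ?G" if g: "continuous_map Z omega_omega g" for g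
  proof -
    define C where "C = (\<lambda>n. {z \<in> topspace Z. if even n then coord n (g z) \<in> B (n div 2)
      else E (coord 1 (g z)) = Some (n div 2)})"
    have "C (2 * k) \<in> \<Gamma>s k" for k
    proof -
      have "continuous_map Z Z (\<lambda>z. h k (coord (2 * k) (g z)))"
        using continuous_map_compose[OF cont_comp'[OF g cont_coord] h] by (simp add: comp_def)
      then have "preimage Z (\<lambda>z. h k (coord (2 * k) (g z))) (A k) \<in> \<Gamma>s k" by (rule \<Gamma>sI)
      moreover have "C (2 * k) = preimage Z (\<lambda>z. h k (coord (2 * k) (g z))) (A k)"
        by (simp add: C_def hB)
      ultimately show ?thesis by simp
    qed
    moreover have "C (2 * k + 1) \<in> Sigma0 \<xi> Z" for k
    proof -
      have "{x. E x = Some k} \<in> Sigma0_omega \<xi>" using E unfolding complete_family_def by blast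
      from Sigma0_vimage[OF cont_comp'[OF g cont_coord] this, of 1] show ?thesis by (simp add: C_def)
    qed
    moreover have "C (2 * i + 1) \<inter> C (2 * j + 1) = {}" if "i \<noteq> j" for i j
      using that by (auto simp: C_def)
    moreover have "preimage Z g W = hausdorff_op Z D C"
      unfolding hausdorff_op_def W_iff by (auto simp: C_def)
    ultimately show ?thesis by blast
  qed
  have G_eq: "?G = {preimage Z f WZ | f. continuous_map Z Z f}"
  proof (intro equalityI subsetI)
    fix Y assume "Y \<in> {preimage Z f WZ | f. continuous_map Z Z f}"
    then obtain g where g: "continuous_map Z Z g" "Y = preimage Z g WZ" by blast
    have "continuous_map Z omega_omega (\<lambda>z. q (i (g z)))"
      using continuous_map_compose[OF g(1) qhat] by (simp add: comp_def)
    from vimage_W[OF this] have "preimage Z (\<lambda>z. q (i (g z))) W \<in> ?G" .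
    moreover have "g z \<in> topspace Z" if "z \<in> topspace Z" for z
      using g(1) that by (auto simp: continuous_map_def)
    then have "Y = preimage Z (\<lambda>z. q (i (g z))) W" unfolding g(2) WZ_def by auto
    ultimately show "Y \<in> ?G" by metis
  next
    fix Y assume "Y \<in> ?G"
    then obtain C where Y: "Y = hausdorff_op Z D C" and C0: "\<And>k. C (2 * k) \<in> \<Gamma>s k"
      and C1: "\<And>k. C (2 * k + 1) \<in> Sigma0 \<xi> Z" and C2: "\<And>i j. i \<noteq> j \<Longrightarrow> C (2 * i + 1) \<inter> C (2 * j + 1) = {}"
      by blast
    have "\<exists>g. continuous_map Z omega_omega g \<and> (\<forall>z. g z \<in> cube S) \<and> C (2 * k) = preimage Z g (B k)" for k
    proof -
      obtain g where g: "continuous_map Z Z g" "C (2 * k) = preimage Z g (A k)" using C0[of k] unfolding \<Gamma>s by blast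
      have "g z \<in> topspace Z" if "z \<in> topspace Z" for z
        using g(1) that by (auto simp: continuous_map_def)
      then have "C (2 * k) = preimage Z (\<lambda>z. f k (g z)) (B k)" unfolding g(2) using fB by auto
      moreover have "continuous_map Z omega_omega (\<lambda>z. f k (g z))"
        using continuous_map_compose[OF g(1) f] by (simp add: comp_def)
      ultimately show ?thesis using fS by blast
    qed
    then obtain g where g: "\<And>k. continuous_map Z omega_omega (g k)" "\<And>k z. g k z \<in> cube S" "\<And>k. C (2 * k) = preimage Z (g k) (B k)"
      by metis
    have "\<exists>\<sigma>. range \<sigma> \<subseteq> {0, 1} \<and> (\<forall>k y. E (strategy_map \<sigma> y) = Some k \<longleftrightarrow> y \<in> {x. r x \<in> C (2 * k + 1)})"
    proof (rule complete_familyD[OF E])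
      show "{x. r x \<in> C (2 * k + 1)} \<in> Sigma0_omega \<xi>" for k using Sigma0_vimage[OF r C1[of k]] by simp
      show "{x. r x \<in> C (2 * i + 1)} \<inter> {x. r x \<in> C (2 * j + 1)} = {}" if "i \<noteq> j" for i j
        using C2[OF that] by blast
    qed
    then obtain \<sigma> where \<sigma>01: "range \<sigma> \<subseteq> {0, 1}" and \<sigma>: "\<And>k y. E (strategy_map \<sigma> y) = Some k \<longleftrightarrow> r y \<in> C (2 * k + 1)" by auto
    \<comment> \<open>All reductions are combined into one; unused coordinates with odd number may be filled arbitrarily
      within the cube.\<close>
    define F where "F = (\<lambda>z p. case prod_decode p of (n, m) \<Rightarrow>
      if n = 1 then strategy_map \<sigma> (i z) m else g (n div 2) z m)"
    have F: "continuous_map Z omega_omega F"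
      unfolding continuous_map_omega_omega
    proof (intro allI)
      fix p a
      obtain n m where p: "prod_decode p = (n, m)" by fastforce
      have "continuous_map Z omega_omega (\<lambda>z. strategy_map \<sigma> (i z))" by (rule cont_comp'[OF i cont_strategy_map])
      then show "openin Z {z \<in> topspace Z. F z p = a}"
        using g(1)[of "n div 2"] unfolding continuous_map_omega_omega
        by (cases "n = 1") (simp_all add: F_def p)
    qed
    have F0: "coord (2 * k) (F z) = g k z" for k z by (auto simp: coord_def F_def)
    have F1: "coord 1 (F z) = strategy_map \<sigma> (i z)" for z by (auto simp: coord_def F_def)
    have FS: "F z \<in> cube S" for z
    proof -
      have "strategy_map \<sigma> (i z) m \<in> S" for m using \<sigma>01 S unfolding strategy_map_def by blast
      then show ?thesis using g(2) by (auto simp: F_def cube_def split: prod.splits)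
    qed
    have "continuous_map Z Z (\<lambda>z. r (e (F z)))"
      using continuous_map_compose[OF F ehat] by (simp add: comp_def)
    moreover have "Y = preimage Z (\<lambda>z. r (e (F z))) WZ"
    proof -
      have "z \<in> Y \<longleftrightarrow> F z \<in> W" if z: "z \<in> topspace Z" for z
      proof -
        have "n \<in> {n. z \<in> C n} \<longleftrightarrow>
            n \<in> {n. if even n then coord n (F z) \<in> B (n div 2) else E (coord 1 (F z)) = Some (n div 2)}" for n
        proof (cases "even n")
          case True
          then obtain k where "n = 2 * k" by blast
          then show ?thesis using z by (simp add: F0 g(3))
        next
          case False
          then obtain k where n: "n = 2 * k + 1" by (blast elim: oddE)
          then show ?thesis unfolding F1 \<sigma> ri[OF z] by simp
        qed
        then have "{n. z \<in> C n} = {n. if even n then coord n (F z) \<in> B (n div 2) else E (coord 1 (F z)) = Some (n div 2)}"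
          by blast
        then show ?thesis using z unfolding Y hausdorff_op_def W_iff by simp
      qed
      moreover have "Y \<subseteq> topspace Z" by (auto simp: Y hausdorff_op_def)
      ultimately show ?thesis by (auto simp: WZ_def rZ qe_hat[OF FS])
    qed
    ultimately show "Y \<in> {preimage Z f WZ | f. continuous_map Z Z f}"
      by (intro CollectI exI[of _ "\<lambda>z. r (e (F z))"]) (rule conjI)
  qed
  have WZ: "WZ \<subseteq> topspace Z" by (auto simp: WZ_def)
  have wc: "wadge_class Z ?G" unfolding wadge_class_def using WZ G_eq by blast
  have "\<not> selfdual Z ?G"
  proof
    assume sd: "selfdual Z ?G"
    have "WZ \<in> ?G" unfolding WZ_def by (rule vimage_W[OF qhat])
    then have "WZ \<in> dual_class Z ?G" using sd by (simp only: selfdual_def)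
    then obtain Y where "WZ = topspace Z - Y" "Y \<in> ?G" unfolding dual_class_def by blast
    moreover from this(2) have "Y \<in> {preimage Z f WZ | f. continuous_map Z Z f}" unfolding G_eq .
    ultimately obtain f where f: "continuous_map Z Z f" "WZ = topspace Z - preimage Z f WZ" by blast
    then have fW: "z \<in> WZ \<longleftrightarrow> f z \<notin> WZ" if "z \<in> topspace Z" for z using that by blast
    have fZ: "f z \<in> topspace Z" if "z \<in> topspace Z" for z
      using f(1) that by (auto simp: continuous_map_def)
    \<comment> \<open>A reduction of \<open>WZ\<close> to its complement in \<open>Z\<close> would induce one of
      \<open>W\<close> on the cube.\<close>
    have "cont (\<lambda>x. q (i (f (r (e x)))))"
      using continuous_map_compose[OF continuous_map_compose[OF ehat f(1)] qhat] by (simp add: comp_def)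
    then obtain x where x: "x \<in> cube S" "q (i (f (r (e x)))) \<in> W \<longleftrightarrow> x \<in> W"
      using universal_diagonal[OF W] by blast
    have "x \<in> W \<longleftrightarrow> r (e x) \<in> WZ" using qe_hat[OF x(1)] by (simp add: WZ_def rZ)
    also have "\<dots> \<longleftrightarrow> f (r (e x)) \<notin> WZ" by (rule fW[OF rZ])
    also have "\<dots> \<longleftrightarrow> q (i (f (r (e x)))) \<notin> W" using fZ[OF rZ] by (simp add: WZ_def)
    finally show False using x(2) by blast
  qed
  then show ?thesis using wc by (simp only: NSD_def mem_Collect_eq simp_thms)
qed

end
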